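(* Let $\mathcal{B}_1,\dots,\mathcal{B}_s$ be integer matrices that are $\mathcal{A}$-graded by $\phi_1,\dots,\phi_s$, respectively, such that the semigroups $\mathbb{N}\mathcal{B}_1^{\phi_1},\dots,\mathbb{N}\mathcal{B}_s^{\phi_s}$ are normal. Then there is a constant $C\in\mathbb{N}$ such that $$\operatorname{mardeg}\Big(\big(\times_{\mathcal{A}}^{r_1}\mathcal{B}_1\big)\times_{\mathcal{A}}\big(\times_{\mathcal{A}}^{r_2}\mathcal{B}_2\big)\times_{\mathcal{A}}\dots\times_{\mathcal{A}}\big(\times_{\mathcal{A}}^{r_s}\mathcal{B}_s\big)\Big)\le C$$ for all $r_1,\dots,r_s\in\mathbb{N}$, not all zero, where factors with $r_i=0$ are omitted.
   Context: $\mathbb{N}=\{0,1,\dots\}$. Let $\mathcal{A}$ be an integer matrix with $t$ columns. For an integer matrix $\mathcal{B}$ with $n$ columns, a surjection $\phi:[n]\to[t]$ induces the linear map $\phi:\mathbb{Z}^n\to\mathbb{Z}^t$, $e_i\mapsto e_{\phi(i)}$; $\mathcal{B}$ is $\mathcal{A}$-graded by $\phi$ if $\phi(\ker_{\mathbb{Z}}\mathcal{B})\subseteq\ker_{\mathbb{Z}}\mathcal{A}$. The toric fiber product of $\mathcal{A}$-graded matrices $\mathcal{C}_1,\dots,\mathcal{C}_k$ (graded by $\chi_1,\dots,\chi_k$) is the matrix $\mathcal{C}_1\times_{\mathcal{A}}\dots\times_{\mathcal{A}}\mathcal{C}_k$ whose columns are the stacked vectors $(c_{1,i_1};\dots;c_{k,i_k})$,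 one for each tuple of column indices $(i_1,\dots,i_k)$ with $\chi_1(i_1)=\dots=\chi_k(i_k)$, where $c_{j,i}$ is the $i$th column of $\mathcal{C}_j$; it is again $\mathcal{A}$-graded by the common value. $\times_{\mathcal{A}}^{r}\mathcal{B}$ is the product of $r$ copies of $\mathcal{B}$ with the same grading. $\mathcal{B}^{\phi}$ is the matrix with columns $\binom{b_i}{\phi(e_i)}$, where $b_i$ is the $i$th column of $\mathcal{B}$. For an integer matrix $M$, $\mathbb{N}M$, $\mathbb{Z}M$, $\mathbb{R}_{\ge}M$ denote the semigroup, lattice and cone generated by its columns; $\mathbb{N}M$ is normal if $\mathbb{N}M=\mathbb{Z}M\cap\mathbb{R}_{\ge}M$. A Markov basis of a matrix $M$ with $k$ columns is a set $\mathcal{M}\subseteq\mathbb{Z}^k$ such that for every integer vector $b$ the undirected graph on $\{v\in\mathbb{N}^k:Mv=b\}$, in which $u,v$ are adjacent iff $u-v\in\pm\mathcal{M}$, is connected. For $v=v^+-v^-$ (positive and negative part), $\deg(v)=\max\{\|v^+\|_1,\|v^-\|_1\}$, $\deg(\mathcal{M})=\sup_{v\in\mathcal{M}}\deg(v)$, and $\operatorname{mardeg}(M)$ is the minimum of $\deg(\mathcal{M})$ over all Markov bases $\mathcal{M}$ of $M$. *)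

theory Defs
  imports
    "Jordan_Normal_Form.Matrix"
    "Jordan_Normal_Form.Matrix_Kernel"
    "HOL-Library.Extended_Nat"
begin

text \<open>The map \<open>\<int>\<^sup>n \<rightarrow> \<int>\<^sup>t\<close>, \<open>e\<^sub>i \<mapsto> e\<^bsub>\<phi> i\<^esub>\<close>, as a matrix. Column indices start at 0.\<close>

definition grading_mat :: "nat \<Rightarrow> nat \<Rightarrow> (nat \<Rightarrow> nat) \<Rightarrow> int mat" where
  "grading_mat t n \<phi> = mat_of_cols t (map (\<lambda>i. unit_vec t (\<phi> i)) [0..<n])"

definition graded_by :: "int mat \<Rightarrow> int mat \<Rightarrow> (nat \<Rightarrow> nat) \<Rightarrow> bool" where
  "graded_by A B \<phi> \<longleftrightarrow>
     \<phi> ` {..<dim_col B} = {..<dim_col A} \<and>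
     (\<lambda>v. grading_mat (dim_col A) (dim_col B) \<phi> *\<^sub>v v) ` mat_kernel B \<subseteq> mat_kernel A"

definition augmented_mat :: "nat \<Rightarrow> int mat \<Rightarrow> (nat \<Rightarrow> nat) \<Rightarrow> int mat" where
  "augmented_mat t B \<phi> =
     mat_of_cols (dim_row B + t) (map (\<lambda>i. col B i @\<^sub>v unit_vec t (\<phi> i)) [0..<dim_col B])"


text \<open>
  A graded matrix is a matrix together with its grading map. The grading matrix \<open>A\<close> itself does
  not enter the construction of the product. The columns of a product are listed in lexicographic
  order of their index tuples. Only nonempty lists of factors are meaningful.
\<close>

type_synonym graded_mat = "int mat \<times> (nat \<Rightarrow> nat)"

definition tfp_tuples :: "graded_mat list \<Rightarrow> nat list list" where
  "tfp_tuples Cs =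
     filter (\<lambda>is. \<exists>c. \<forall>j<length Cs. snd (Cs ! j) (is ! j) = c)
       (product_lists (map (\<lambda>(C, \<chi>). [0..<dim_col C]) Cs))"

definition tfp_column :: "graded_mat list \<Rightarrow> nat list \<Rightarrow> int vec" where
  "tfp_column Cs is = foldr (@\<^sub>v) (map2 (\<lambda>(C, \<chi>) i. col C i) Cs is) vNil"

definition toric_fiber_product :: "graded_mat list \<Rightarrow> graded_mat" where
  "toric_fiber_product Cs =
     (mat_of_cols (sum_list (map (\<lambda>(C, \<chi>). dim_row C) Cs))
        (map (tfp_column Cs) (tfp_tuples Cs)),
      \<lambda>m. snd (Cs ! 0) (tfp_tuples Cs ! m ! 0))"

definition tfp_power :: "nat \<Rightarrow> graded_mat \<Rightarrow> graded_mat" where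
  "tfp_power r G = toric_fiber_product (replicate r G)"


definition semigroup_of :: "int mat \<Rightarrow> int vec set" where
  "semigroup_of M = {M *\<^sub>v x | x. x \<in> carrier_vec (dim_col M) \<and> 0\<^sub>v (dim_col M) \<le> x}"

definition lattice_of_cols :: "int mat \<Rightarrow> int vec set" where
  "lattice_of_cols M = {M *\<^sub>v x | x. x \<in> carrier_vec (dim_col M)}"

definition cone_of :: "int mat \<Rightarrow> real vec set" where
  "cone_of M = {map_mat real_of_int M *\<^sub>v x | x.
     x \<in> carrier_vec (dim_col M) \<and> 0\<^sub>v (dim_col M) \<le> x}"

definition normal_semigroup :: "int mat \<Rightarrow> bool" where
  "normal_semigroup M \<longleftrightarrow>
     semigroup_of M = {v \<in> lattice_of_cols M. map_vec real_of_int v \<in> cone_of M}"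


text \<open>Vectors of natural numbers are represented as nonnegative integer vectors.\<close>

definition fiber :: "int mat \<Rightarrow> int vec \<Rightarrow> int vec set" where
  "fiber M b = {v \<in> carrier_vec (dim_col M). 0\<^sub>v (dim_col M) \<le> v \<and> M *\<^sub>v v = b}"

definition fiber_edges :: "int mat \<Rightarrow> int vec set \<Rightarrow> int vec \<Rightarrow> (int vec \<times> int vec) set" where
  "fiber_edges M S b =
     {(u, v). u \<in> fiber M b \<and> v \<in> fiber M b \<and> (u - v \<in> S \<or> - (u - v) \<in> S)}"

text \<open>Connectedness of a fiber graph; the empty graph counts as connected.\<close>

definition markov_basis :: "int mat \<Rightarrow> int vec set \<Rightarrow> bool" where
  "markov_basis M S \<longleftrightarrow>
     S \<subseteq> carrier_vec (dim_col M) \<and>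
     (\<forall>b \<in> carrier_vec (dim_row M).
        \<forall>u \<in> fiber M b. \<forall>v \<in> fiber M b. (u, v) \<in> (fiber_edges M S b)\<^sup>*)"

text \<open>For an integer \<open>x\<close>, \<open>nat x\<close> and \<open>nat (- x)\<close> are its positive and negative parts.\<close>

definition vec_deg :: "int vec \<Rightarrow> nat" where
  "vec_deg v = max (\<Sum>i<dim_vec v. nat (v $ i)) (\<Sum>i<dim_vec v. nat (- (v $ i)))"

definition set_deg :: "int vec set \<Rightarrow> enat" where
  "set_deg S = (SUP v\<in>S. enat (vec_deg v))"

text \<open>
  The infimum is a minimum: \<open>enat\<close> is well-ordered and the set of all integer vectors is a
  Markov basis.
\<close>

definition mardeg :: "int mat \<Rightarrow> enat" where
  "mardeg M = (INF S\<in>{S. markov_basis M S}. set_deg S)"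

end

theory Submission
  imports Defs "HOL-Library.Multiset"
begin

text \<open>
  A vector in a fiber of the product is a table: a multiset of tuples of columns, one column from each
  factor, all of the same grade. Its marginal in a factor counts the columns used there, and all its
  marginals have the same multiset of grades, the grade of the table. A fiber prescribes the image of
  every marginal under the matrix of its factor, but not the grade. The task is to connect any two
  tables of a fiber by exchanging boundedly many tuples at a time, with a bound that does not depend
  on the number of factors. There are three stages.

  First the grade is corrected. By normality, the grades that are possible in one factor, for a
  prescribed image, are the lattice points of a polyhedron whose facet normals depend only on the
  factor (\<open>normal_interval\<close>, by way of \<open>cone_halfspaces\<close>). Hence the grades possible in a fiber of
  the product are the lattice points of a polyhedron whose facet normals come from one finite list,
  however many copies of the factors are multiplied; only the right-hand sides vary. So Dickson's
  lemma, applied to the values of the normals, yields finitely many shifts that connect these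
  points within every such polyhedron (\<open>conformal_generators\<close>). A second use of Dickson's lemma
  shows that each shift can be realized in each factor by exchanging boundedly many columns
  (\<open>grade_steps_exist\<close>). All factors have to undergo the same shift simultaneously, and yet only a
  bounded part of the table must be involved: this is \<open>moves_replace_marginals\<close>.

  Once two tables have the same grade, their marginals can be corrected in one factor after the other,
  by finitely many changes that preserve image and grade (\<open>kernel_steps_exist\<close>). Finally,
  tables with equal marginals are connected by swapping components between two tuples of the same
  grade (\<open>moves_equal_marginals\<close>).
\<close>

section \<open>Two finiteness principles\<close>

text \<open>
  Dickson's lemma, with the elements of \<open>S\<close> weighed by natural numbers indexed by \<open>K\<close>. If \<open>F\<close>
  dominates \<open>S\<close> on the indices other than \<open>k\<close>, then it fails only on elements whose weight at \<open>k\<close> is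
  below that of some member of \<open>F\<close>. They lie in finitely many slices of constant weight at \<open>k\<close>, and
  each slice has a finite dominating set of its own.
\<close>

lemma dickson:
  fixes w :: "'a \<Rightarrow> 'k \<Rightarrow> nat"
  assumes "finite K"
  shows "\<exists>F\<subseteq>S. finite F \<and> (\<forall>x\<in>S. \<exists>y\<in>F. \<forall>k\<in>K. w y k \<le> w x k)"
  using assms
proof (induction K arbitrary: S rule: finite_induct)
  case empty
  show ?case
  proof (cases "S = {}")
    case False
    then obtain a where "a \<in> S" by blast
    then show ?thesis by (intro exI[of _ "{a}"]) auto
  qed auto
next
  case (insert k K)
  obtain F where F: "F \<subseteq> S" "finite F" "\<forall>x\<in>S. \<exists>y\<in>F. \<forall>k\<in>K. w y k \<le> w x k"
    using insert.IH by blast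
  define m where "m = (\<Sum>y\<in>F. w y k)"
  have m: "w y k \<le> m" if "y \<in> F" for y
    unfolding m_def using member_le_sum[of y F "\<lambda>y. w y k"] that F(2) by auto
  obtain E where E: "\<And>v. E v \<subseteq> {x\<in>S. w x k = v}" "\<And>v. finite (E v)"
      "\<And>v. \<forall>x\<in>{x\<in>S. w x k = v}. \<exists>y\<in>E v. \<forall>k\<in>K. w y k \<le> w x k"
  proof -
    have "\<forall>v. \<exists>E\<subseteq>{x\<in>S. w x k = v}. finite E \<and>
        (\<forall>x\<in>{x\<in>S. w x k = v}. \<exists>y\<in>E. \<forall>k\<in>K. w y k \<le> w x k)"
      by (intro allI insert.IH)
    then obtain E where "\<forall>v. E v \<subseteq> {x\<in>S. w x k = v} \<and> finite (E v) \<and>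
        (\<forall>x\<in>{x\<in>S. w x k = v}. \<exists>y\<in>E v. \<forall>k\<in>K. w y k \<le> w x k)"
      by (rule choice[THEN exE])
    then show thesis by (intro that[of E]) simp_all
  qed
  show ?case
  proof (intro exI[of _ "F \<union> (\<Union>v<m. E v)"] conjI ballI)
    fix x assume x: "x \<in> S"
    show "\<exists>y\<in>F \<union> (\<Union>v<m. E v). \<forall>k\<in>insert k K. w y k \<le> w x k"
    proof (cases "w x k < m")
      case True
      from E(3)[of "w x k"] x obtain y where y: "y \<in> E (w x k)" "\<forall>k\<in>K. w y k \<le> w x k" by auto
      have "w y k = w x k" using E(1)[of "w x k"] y(1) by auto
      with y True show ?thesis by (intro bexI[of _ y]) auto
    next
      case False
      from F(3) x obtain y where "y \<in> F" "\<forall>k\<in>K. w y k \<le> w x k" by auto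
      with m[of y] False show ?thesis by (intro bexI[of _ y]) auto
    qed
  qed (use F E(2) subsetD[OF E(1)] in auto)
qed

text \<open>
  The Minkowski-Weyl theorem by Fourier-Motzkin elimination, one generator at a time: \<open>w\<close> lies in
  the larger cone iff \<open>w - l v\<close> lies in the smaller one for some \<open>l \<ge> 0\<close>, and an inequality of
  the smaller cone bounds \<open>l\<close> from above, from below or not at all. Eliminating \<open>l\<close> forms only integer combinations
  of inequalities, so that integer generators lead to integer functionals. Integrality is what makes
  Dickson's lemma applicable to the values of these functionals later on.
\<close>

lemma cone_halfspaces:
  fixes \<gamma> :: "nat \<Rightarrow> nat \<Rightarrow> int" and n N :: nat
  shows "\<exists>H :: (nat \<Rightarrow> int) set. finite H \<and>
    (\<forall>w :: nat \<Rightarrow> real.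
      (\<exists>y. (\<forall>x<n. 0 \<le> y x) \<and> (\<forall>k<N. w k = (\<Sum>x<n. of_int (\<gamma> x k) * y x))) \<longleftrightarrow>
      (\<forall>h\<in>H. 0 \<le> (\<Sum>k<N. of_int (h k) * w k)))"
proof (induction n)
  case 0
  \<comment> \<open>The cone of no generators is \<open>{0}\<close>, cut out by both signs of every coordinate.\<close>
  define e :: "int \<Rightarrow> nat \<Rightarrow> nat \<Rightarrow> int" where "e s j k = (if k = j then s else 0)" for s j k
  have e: "(\<Sum>k<N. of_int (e s j k) * w k) = of_int s * w j" if "j < N" for s j and w :: "nat \<Rightarrow> real"
    unfolding e_def using that by (simp add: if_distrib[of of_int] if_distrib[of "\<lambda>u. u * _"] cong: if_cong)
  show ?case
  proof (intro exI[of _ "(e 1 ` {..<N}) \<union> (e (-1) ` {..<N})"] conjI allI)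
    fix w :: "nat \<Rightarrow> real"
    show "(\<exists>y. (\<forall>x<0::nat. 0 \<le> y x) \<and> (\<forall>k<N. w k = (\<Sum>x<0. of_int (\<gamma> x k) * y x))) \<longleftrightarrow>
      (\<forall>h\<in>(e 1 ` {..<N}) \<union> (e (-1) ` {..<N}). 0 \<le> (\<Sum>k<N. of_int (h k) * w k))"
      by (auto simp: e ball_Un intro!: antisym)
  qed auto
next
  case (Suc n)
  define dot :: "(nat \<Rightarrow> int) \<Rightarrow> (nat \<Rightarrow> real) \<Rightarrow> real" where
    "dot h w = (\<Sum>k<N. of_int (h k) * w k)" for h w
  define cone where "cone m w \<longleftrightarrow>
    (\<exists>y. (\<forall>x<m. 0 \<le> y x) \<and> (\<forall>k<N. w k = (\<Sum>x<m. of_int (\<gamma> x k) * y x)))"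
    for m and w :: "nat \<Rightarrow> real"
  from Suc obtain H :: "(nat \<Rightarrow> int) set" where H: "finite H"
      "\<And>w. cone n w \<longleftrightarrow> (\<forall>h\<in>H. 0 \<le> dot h w)"
    unfolding dot_def cone_def by blast
  define p where "p h = (\<Sum>k<N. h k * \<gamma> n k)" for h
  \<comment> \<open>The combination of \<open>h1\<close> and \<open>h2\<close> that vanishes on the new generator.\<close>
  define q where "q h1 h2 k = p h1 * h2 k - p h2 * h1 k" for h1 h2 k
  define H' where "H' = {h\<in>H. 0 \<le> p h} \<union> (\<lambda>(h1, h2). q h1 h2) ` ({h\<in>H. 0 < p h} \<times> {h\<in>H. p h < 0})"
  have dq: "dot (q h1 h2) w = p h1 * dot h2 w - p h2 * dot h1 w" for h1 h2 w
    unfolding dot_def q_def by (simp add: algebra_simps sum_subtractf sum_distrib_left)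
  have dw: "dot h (\<lambda>k. w k - l * real_of_int (\<gamma> n k)) = dot h w - l * p h" for h w l
    unfolding dot_def p_def by (simp add: algebra_simps sum_subtractf sum_distrib_left)
  have step: "cone (Suc n) w \<longleftrightarrow> (\<exists>l\<ge>0. cone n (\<lambda>k. w k - l * real_of_int (\<gamma> n k)))" for w
  proof
    assume "cone (Suc n) w"
    then obtain y where "\<forall>x<Suc n. 0 \<le> y x" "\<forall>k<N. w k = (\<Sum>x<Suc n. of_int (\<gamma> x k) * y x)"
      unfolding cone_def by blast
    then show "\<exists>l\<ge>0. cone n (\<lambda>k. w k - l * real_of_int (\<gamma> n k))"
      unfolding cone_def by (intro exI[of _ "y n"]) (auto intro!: exI[of _ y])
  next
    assume "\<exists>l\<ge>0. cone n (\<lambda>k. w k - l * real_of_int (\<gamma> n k))"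
    then obtain l where l: "l \<ge> 0" "cone n (\<lambda>k. w k - l * real_of_int (\<gamma> n k))" by blast
    from l(2) obtain y where y: "\<forall>x<n. 0 \<le> y x"
        "\<forall>k<N. w k - l * real_of_int (\<gamma> n k) = (\<Sum>x<n. of_int (\<gamma> x k) * y x)"
      unfolding cone_def by (elim exE conjE)
    define y' where "y' = y(n := l)"
    have "(\<Sum>x<n. of_int (\<gamma> x k) * y' x) = (\<Sum>x<n. of_int (\<gamma> x k) * y x)" for k
      unfolding y'_def by (intro sum.cong) auto
    moreover have "0 \<le> y' x" if "x < Suc n" for x
      unfolding y'_def using that l(1) y(1) by (cases "x = n") auto
    ultimately show "cone (Suc n) w"
      unfolding cone_def using y(2)
      by (intro exI[of _ y']) (auto simp: y'_def algebra_simps)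
  qed
  have key: "(\<exists>l\<ge>0. \<forall>h\<in>H. 0 \<le> dot h w - l * real_of_int (p h)) \<longleftrightarrow> (\<forall>h\<in>H'. 0 \<le> dot h w)" for w
  proof
    assume "\<exists>l\<ge>0. \<forall>h\<in>H. 0 \<le> dot h w - l * real_of_int (p h)"
    then obtain l :: real where l: "l \<ge> 0" "\<And>h. h \<in> H \<Longrightarrow> l * p h \<le> dot h w" by auto
    show "\<forall>h\<in>H'. 0 \<le> dot h w"
    proof
      fix h assume "h \<in> H'"
      then consider "h \<in> H" "0 \<le> p h"
        | h1 h2 where "h = q h1 h2" "h1 \<in> H" "h2 \<in> H" "0 < p h1" "p h2 < 0"
        unfolding H'_def by auto
      then show "0 \<le> dot h w"
      proof cases
        case 1
        have "0 \<le> l * p h" using 1 l(1) by simp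
        with l(2)[OF 1(1)] show ?thesis by linarith
      next
        case 2
        have a: "real_of_int (p h1) * (l * p h2) \<le> p h1 * dot h2 w"
          by (intro mult_left_mono l(2) 2) (use 2 in auto)
        have b: "real_of_int (- p h2) * (l * p h1) \<le> (- p h2) * dot h1 w"
          by (intro mult_left_mono l(2) 2) (use 2 in auto)
        from a b show ?thesis unfolding 2(1) dq by (simp add: algebra_simps)
      qed
    qed
  next
    assume R: "\<forall>h\<in>H'. 0 \<le> dot h w"
    \<comment> \<open>The least \<open>l\<close> allowed by the lower bounds; the combinations \<open>q\<close> say that it meets the upper ones.\<close>
    define T where "T = insert 0 ((\<lambda>h. dot h w / p h) ` {h\<in>H. p h < 0})"
    have T: "finite T" "T \<noteq> {}" unfolding T_def using H(1) by auto
    define l where "l = Max T"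
    have lT: "x \<le> l" if "x \<in> T" for x unfolding l_def using T that by auto
    have l0: "l \<ge> 0" by (rule lT) (simp add: T_def)
    have "0 \<le> dot h w - l * real_of_int (p h)" if h: "h \<in> H" for h
    proof -
      consider "p h < 0" | "p h = 0" | "p h > 0" by linarith
      then show ?thesis
      proof cases
        case 1
        then have "dot h w / p h \<le> l" using h by (intro lT) (auto simp: T_def)
        then show ?thesis using 1 by (simp add: divide_le_eq)
      next
        case 2
        then show ?thesis using R h unfolding H'_def by auto
      next
        case 3
        have "l \<in> T" unfolding l_def using T by simp
        then consider "l = 0" | h2 where "h2 \<in> H" "p h2 < 0" "l = dot h2 w / p h2"
          unfolding T_def by auto
        then show ?thesis
        proof cases
          case 1
          then show ?thesis using R h 3 unfolding H'_def by auto
        next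
          case 2
          have "q h h2 \<in> H'" unfolding H'_def using h 3 2 by auto
          with R have "0 \<le> dot (q h h2) w" by blast
          moreover have "dot h2 w = l * p h2" using 2 by simp
          ultimately have "real_of_int (p h2) * dot h w \<le> real_of_int (p h2) * (l * p h)"
            unfolding dq by (simp add: algebra_simps)
          then show ?thesis using 2(2) by (simp add: mult_le_cancel_left_neg)
        qed
      qed
    qed
    with l0 show "\<exists>l\<ge>0. \<forall>h\<in>H. 0 \<le> dot h w - l * real_of_int (p h)" by blast
  qed
  have "finite H'" unfolding H'_def using H(1) by simp
  moreover have "cone (Suc n) w \<longleftrightarrow> (\<forall>h\<in>H'. 0 \<le> dot h w)" for w
    unfolding step H(2) dw key ..
  ultimately show ?case unfolding cone_def dot_def by blast
qed

section \<open>Normality as an interval property of grades\<close>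

text \<open>
  A nonnegative vector is treated as the multiset of the column indices that it counts. This makes it
  possible to split off parts of a vector and to pass to grades with the image operation on multisets.
\<close>

definition same_image :: "int mat \<Rightarrow> nat multiset \<Rightarrow> nat multiset \<Rightarrow> bool" where
  "same_image B X Y \<longleftrightarrow> (\<forall>k<dim_row B. (\<Sum>x\<in>#X. B $$ (k, x)) = (\<Sum>x\<in>#Y. B $$ (k, x)))"

text \<open>
  The group \<open>\<phi>(ker B)\<close>, with \<open>z\<close> ranging over the integer kernel.
\<close>

definition kernel_grades :: "graded_mat \<Rightarrow> (nat \<Rightarrow> int) set" where
  "kernel_grades G = {\<lambda>c. \<Sum>x | x < dim_col (fst G) \<and> snd G x = c. z x | z.
     \<forall>k<dim_row (fst G). (\<Sum>x<dim_col (fst G). fst G $$ (k, x) * z x) = 0}"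

definition grade_count :: "(nat \<Rightarrow> nat) \<Rightarrow> nat multiset \<Rightarrow> nat \<Rightarrow> int" where
  "grade_count \<phi> X c = int (count (image_mset \<phi> X) c)"

lemma sum_mset_eq_sum_count:
  fixes f :: "nat \<Rightarrow> int"
  assumes "set_mset X \<subseteq> {..<n}"
  shows "(\<Sum>x\<in>#X. f x) = (\<Sum>x<n. f x * int (count X x))"
  using assms
proof (induction X)
  case (add a X)
  have "(\<Sum>x<n. f x * int (count (add_mset a X) x))
      = (\<Sum>x<n. f x * int (count X x) + (if x = a then f x else 0))"
    by (intro sum.cong) (auto simp: algebra_simps)
  also have "\<dots> = (\<Sum>x<n. f x * int (count X x)) + f a"
    using add.prems by (simp add: sum.distrib)
  finally show ?case using add by simp
qed simp

lemma grade_count_eq_sum: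
  assumes "set_mset X \<subseteq> {..<n}"
  shows "grade_count \<phi> X c = (\<Sum>x | x < n \<and> \<phi> x = c. int (count X x))"
proof -
  have "grade_count \<phi> X c = (\<Sum>x\<in>#X. if \<phi> x = c then 1 else 0)"
    unfolding grade_count_def by (induction X) auto
  also have "\<dots> = (\<Sum>x<n. (if \<phi> x = c then 1 else 0) * int (count X x))"
    by (rule sum_mset_eq_sum_count[OF assms])
  also have "\<dots> = (\<Sum>x<n. if \<phi> x = c then int (count X x) else 0)"
    by (intro sum.cong) auto
  also have "\<dots> = (\<Sum>x | x < n \<and> \<phi> x = c. int (count X x))"
    by (subst sum.If_cases) (auto intro: sum.cong)
  finally show ?thesis .
qed

lemma multiset_with_counts:
  fixes v :: "nat \<Rightarrow> int"
  assumes "\<And>x. x < n \<Longrightarrow> 0 \<le> v x"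
  obtains Z where "set_mset Z \<subseteq> {..<n}" "\<And>x. x < n \<Longrightarrow> int (count Z x) = v x"
proof
  define Z where "Z = (\<Sum>x<n. replicate_mset (nat (v x)) x)"
  have Z: "count Z x = (if x < n then nat (v x) else 0)" for x
  proof -
    have "count Z x = (\<Sum>i<n. if i = x then nat (v i) else 0)"
      unfolding Z_def count_sum by (intro sum.cong) auto
    then show ?thesis by simp
  qed
  show "set_mset Z \<subseteq> {..<n}"
  proof
    fix x assume "x \<in># Z"
    then have "count Z x \<noteq> 0" by simp
    then show "x \<in> {..<n}" unfolding Z by (simp split: if_splits)
  qed
  show "int (count Z x) = v x" if "x < n" for x
    unfolding Z using that assms by simp
qed

lemma augmented_mat_index:
  assumes "x < dim_col B"
  shows "k < dim_row B \<Longrightarrow> augmented_mat t B \<phi> $$ (k, x) = B $$ (k, x)"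
    and "c < t \<Longrightarrow> \<phi> x < t \<Longrightarrow> augmented_mat t B \<phi> $$ (dim_row B + c, x) = (if \<phi> x = c then 1 else 0)"
  using assms by (auto simp: augmented_mat_def mat_of_cols_index)

lemma mult_mat_vec_index:
  assumes "k < dim_row M" "v \<in> carrier_vec (dim_col M)"
  shows "(M *\<^sub>v v) $ k = (\<Sum>x<dim_col M. M $$ (k, x) * v $ x)"
  using assms by (auto simp: scalar_prod_def atLeast0LessThan intro: sum.cong)

text \<open>
  Fix \<open>X\<close>, put \<open>d\<close> for the difference of the grades of \<open>X\<close> and \<open>Y\<close>, and let \<open>g\<close> be a further grade
  difference coming from the kernel. The question is whether the image of \<open>X\<close> is attained in
  the grade of \<open>X\<close> shifted by \<open>g\<close>. The augmented vector belongs to the lattice, and by normality it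
  remains to check the inequalities of the cone. Such an inequality is affine in the grade and holds at
  the shifts by \<open>0\<close> and by \<open>d\<close>, so it holds at \<open>g\<close> as soon as its linear part takes there a value
  not below both of these. The point is that \<open>H\<close> depends neither on \<open>X\<close> nor on \<open>Y\<close>.
\<close>

lemma normal_interval:
  fixes B :: "int mat"
  assumes normal: "normal_semigroup (augmented_mat t B \<phi>)"
    and \<phi>: "\<And>x. x < dim_col B \<Longrightarrow> \<phi> x < t"
  shows "\<exists>H :: (nat \<Rightarrow> int) set. finite H \<and>
    (\<forall>X Y g. set_mset X \<subseteq> {..<dim_col B} \<longrightarrow> set_mset Y \<subseteq> {..<dim_col B} \<longrightarrow>
      same_image B X Y \<longrightarrow> g \<in> kernel_grades (B, \<phi>) \<longrightarrow>
      (\<forall>h\<in>H. min 0 (\<Sum>c<t. h c * (grade_count \<phi> Y c - grade_count \<phi> X c)) \<le> (\<Sum>c<t. h c * g c)) \<longrightarrow>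
      (\<exists>Z. set_mset Z \<subseteq> {..<dim_col B} \<and> same_image B X Z \<and>
           (\<forall>c. grade_count \<phi> Z c = grade_count \<phi> X c + g c)))"
proof -
  define n R N where "n = dim_col B" and "R = dim_row B" and "N = augmented_mat t B \<phi>"
  have dN: "dim_row N = R + t" "dim_col N = n"
    unfolding N_def R_def n_def augmented_mat_def by auto
  define img :: "(nat \<Rightarrow> int) \<Rightarrow> nat \<Rightarrow> int" where
    "img f k = (\<Sum>x<n. N $$ (k, x) * f x)" for f k
  have img1: "img f k = (\<Sum>x<n. B $$ (k, x) * f x)" if "k < R" for f k
    unfolding img_def using that by (auto simp: N_def n_def R_def augmented_mat_index intro!: sum.cong)
  have img2: "img f (R + c) = (\<Sum>x | x < n \<and> \<phi> x = c. f x)" if "c < t" for f c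
  proof -
    have "img f (R + c) = (\<Sum>x<n. if \<phi> x = c then f x else 0)"
      unfolding img_def using that
      by (auto simp: N_def n_def R_def augmented_mat_index \<phi> intro!: sum.cong)
    also have "\<dots> = (\<Sum>x | x < n \<and> \<phi> x = c. f x)"
      by (subst sum.If_cases) (auto intro: sum.cong)
    finally show ?thesis .
  qed
  have img_add: "img (\<lambda>x. f x + g x) k = img f k + img g k" for f g k
    unfolding img_def by (simp add: algebra_simps sum.distrib)
  have img_vec: "(N *\<^sub>v v) $ k = img (($) v) k" if "k < R + t" "v \<in> carrier_vec n" for v k
    using that mult_mat_vec_index[of k N v] unfolding img_def dN by simp
  obtain H0 :: "(nat \<Rightarrow> int) set" where H0: "finite H0"
    "\<And>w :: nat \<Rightarrow> real. (\<exists>y. (\<forall>x<n. 0 \<le> y x) \<and> (\<forall>k<R+t. w k = (\<Sum>x<n. of_int (N $$ (k, x)) * y x))) \<longleftrightarrow>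
      (\<forall>h\<in>H0. 0 \<le> (\<Sum>k<R+t. of_int (h k) * w k))"
    using cone_halfspaces[where \<gamma> = "\<lambda>x k. N $$ (k, x)" and n = n and N = "R + t"] by blast
  define dot :: "(nat \<Rightarrow> int) \<Rightarrow> (nat \<Rightarrow> int) \<Rightarrow> int" where
    "dot h f = (\<Sum>k<R+t. h k * img f k)" for h f
  have dot_real: "(\<Sum>k<R+t. of_int (h k) * real_of_int (img f k)) = of_int (dot h f)" for h f
    unfolding dot_def by simp
  have dot_split: "dot h f = (\<Sum>k<R. h k * img f k) + (\<Sum>c<t. h (R + c) * img f (R + c))" for h f
  proof -
    have "(\<Sum>k=R..<R+t. h k * img f k) = (\<Sum>c<t. h (R + c) * img f (R + c))"
      by (rule sum.reindex_bij_witness[of _ "\<lambda>c. R + c" "\<lambda>k. k - R"]) auto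
    then show ?thesis
      using sum.atLeastLessThan_concat[of 0 R "R + t" "\<lambda>k. h k * img f k"]
      unfolding dot_def lessThan_atLeast0 by linarith
  qed
  have dot_nonneg: "0 \<le> dot h f" if "h \<in> H0" "\<And>x. x < n \<Longrightarrow> 0 \<le> f x" for h f
  proof -
    have "\<forall>h\<in>H0. 0 \<le> (\<Sum>k<R+t. of_int (h k) * real_of_int (img f k))"
      unfolding H0(2)[symmetric]
      by (intro exI[of _ "\<lambda>x. real_of_int (f x)"]) (auto simp: that img_def)
    with that(1) show ?thesis unfolding dot_real by auto
  qed
  show ?thesis
  proof (intro exI[of _ "(\<lambda>h c. h (R + c)) ` H0"] conjI allI impI)
    fix X Y g
    assume X: "set_mset X \<subseteq> {..<dim_col B}" and Y: "set_mset Y \<subseteq> {..<dim_col B}"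
      and same: "same_image B X Y" and g: "g \<in> kernel_grades (B, \<phi>)"
      and le: "\<forall>h\<in>(\<lambda>h c. h (R + c)) ` H0.
        min 0 (\<Sum>c<t. h c * (grade_count \<phi> Y c - grade_count \<phi> X c)) \<le> (\<Sum>c<t. h c * g c)"
    from g obtain z where z: "\<And>k. k < R \<Longrightarrow> (\<Sum>x<n. B $$ (k, x) * z x) = 0"
      "g = (\<lambda>c. \<Sum>x | x < n \<and> \<phi> x = c. z x)"
      unfolding kernel_grades_def R_def n_def by auto
    define cX cY where "cX = (\<lambda>x. int (count X x))" and "cY = (\<lambda>x. int (count Y x))"
    have gX: "img cX (R + c) = grade_count \<phi> X c" and gY: "img cY (R + c) = grade_count \<phi> Y c"
      if "c < t" for c
      using img2[OF that] grade_count_eq_sum[OF X[folded n_def]] grade_count_eq_sum[OF Y[folded n_def]]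
      unfolding cX_def cY_def by auto
    have gz: "img z (R + c) = g c" if "c < t" for c using img2[OF that] z(2) by simp
    have XY: "img cX k = img cY k" if "k < R" for k
      using same that sum_mset_eq_sum_count[OF X] sum_mset_eq_sum_count[OF Y]
      unfolding same_image_def img1[OF that] cX_def cY_def n_def R_def by auto
    have dY: "dot h cY = dot h cX + (\<Sum>c<t. h (R + c) * (grade_count \<phi> Y c - grade_count \<phi> X c))" for h
      unfolding dot_split by (simp add: XY gX gY right_diff_distrib sum_subtractf)
    have z0: "img z k = 0" if "k < R" for k using z(1) img1 that by simp
    define f where "f = (\<lambda>x. cX x + z x)"
    have df: "dot h f = dot h cX + (\<Sum>c<t. h (R + c) * g c)" for h
      unfolding dot_split f_def img_add by (simp add: z0 gz distrib_left sum.distrib)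
    have pos: "0 \<le> dot h f" if h: "h \<in> H0" for h
    proof -
      have "0 \<le> dot h cX" "0 \<le> dot h cY" by (auto intro!: dot_nonneg h simp: cX_def cY_def)
      moreover have "min 0 (\<Sum>c<t. h (R + c) * (grade_count \<phi> Y c - grade_count \<phi> X c)) \<le> (\<Sum>c<t. h (R + c) * g c)"
        using le h by auto
      ultimately show ?thesis using dY[of h] df[of h] by linarith
    qed
    then have "\<forall>h\<in>H0. 0 \<le> (\<Sum>k<R+t. of_int (h k) * real_of_int (img f k))"
      unfolding dot_real by auto
    then obtain y where y: "\<forall>x<n. 0 \<le> y x"
      "\<forall>k<R+t. real_of_int (img f k) = (\<Sum>x<n. of_int (N $$ (k, x)) * y x)"
      unfolding H0(2)[symmetric] by blast
    define w where "w = N *\<^sub>v vec n f"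
    have w_k: "w $ k = img f k" if "k < R + t" for k
      unfolding w_def using img_vec[OF that, of "vec n f"] by (auto simp: img_def intro: sum.cong)
    have w_dim: "dim_vec w = R + t" unfolding w_def by (simp add: dN)
    have "w \<in> lattice_of_cols N" unfolding lattice_of_cols_def w_def dN by auto
    moreover have "map_vec real_of_int w \<in> cone_of N"
      unfolding cone_of_def mem_Collect_eq dN
    proof (intro exI[of _ "vec n y"] conjI)
      show "map_vec real_of_int w = map_mat real_of_int N *\<^sub>v vec n y"
      proof (rule eq_vecI)
        fix k assume "k < dim_vec (map_mat real_of_int N *\<^sub>v vec n y)"
        then have k: "k < R + t" by (simp add: dN)
        have "(map_mat real_of_int N *\<^sub>v vec n y) $ k = (\<Sum>x<n. of_int (N $$ (k, x)) * y x)"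
          using mult_mat_vec_index[of k "map_mat real_of_int N" "vec n y"] k
          by (auto simp: dN intro: sum.cong)
        then show "map_vec real_of_int w $ k = (map_mat real_of_int N *\<^sub>v vec n y) $ k"
          using y(2) k w_k[OF k] w_dim by simp
      qed (simp add: w_dim dN)
    qed (use y in \<open>auto simp: less_eq_vec_def\<close>)
    ultimately have "w \<in> semigroup_of N"
      using normal unfolding normal_semigroup_def N_def by blast
    then obtain v where v: "v \<in> carrier_vec n" "0\<^sub>v n \<le> v" "w = N *\<^sub>v v"
      unfolding semigroup_of_def dN by auto
    obtain Z where Zn: "set_mset Z \<subseteq> {..<n}" and Zc: "\<And>x. x < n \<Longrightarrow> int (count Z x) = v $ x"
      using multiset_with_counts[of n "($) v"] v(1,2) by (auto simp: less_eq_vec_def)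
    have imgZ: "img (\<lambda>x. int (count Z x)) k = img f k" if "k < R + t" for k
    proof -
      have "img (\<lambda>x. int (count Z x)) k = img (($) v) k"
        unfolding img_def by (intro sum.cong) (auto simp: Zc)
      then show ?thesis using img_vec[OF that v(1)] w_k[OF that] v(3) by simp
    qed
    show "\<exists>Z. set_mset Z \<subseteq> {..<dim_col B} \<and> same_image B X Z \<and>
           (\<forall>c. grade_count \<phi> Z c = grade_count \<phi> X c + g c)"
    proof (intro exI[of _ Z] conjI allI)
      show "same_image B X Z"
        unfolding same_image_def
      proof (intro allI impI)
        fix k assume "k < dim_row B"
        then have k: "k < R" by (simp add: R_def)
        have "(\<Sum>x\<in>#Z. B $$ (k, x)) = img (\<lambda>x. int (count Z x)) k"
          using sum_mset_eq_sum_count[OF Zn] img1[OF k] by simp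
        also have "\<dots> = img cX k" using imgZ[of k] k z0[OF k] by (simp add: f_def img_add)
        also have "\<dots> = (\<Sum>x\<in>#X. B $$ (k, x))"
          using sum_mset_eq_sum_count[OF X] img1[OF k] by (simp add: n_def cX_def)
        finally show "(\<Sum>x\<in>#X. B $$ (k, x)) = (\<Sum>x\<in>#Z. B $$ (k, x))" by simp
      qed
    next
      fix c
      show "grade_count \<phi> Z c = grade_count \<phi> X c + g c"
      proof (cases "c < t")
        case True
        have "grade_count \<phi> Z c = img (\<lambda>x. int (count Z x)) (R + c)"
          using grade_count_eq_sum[OF Zn] img2[OF True] by simp
        then show ?thesis using imgZ[of "R + c"] True gX gz by (simp add: f_def img_add)
      next
        case False
        then have e: "{x. x < n \<and> \<phi> x = c} = {}" using \<phi> by (auto simp: n_def)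
        show ?thesis
          unfolding grade_count_eq_sum[OF Zn] grade_count_eq_sum[OF X[folded n_def]] z(2) e by simp
      qed
    qed (use Zn n_def in simp)
  qed (use H0(1) in simp)
qed

section \<open>Finitely many local changes\<close>

lemma grade_count_union: "grade_count \<phi> (X + Y) c = grade_count \<phi> X c + grade_count \<phi> Y c"
  by (simp add: grade_count_def)

lemma grade_count_eq_iff: "image_mset \<phi> X = image_mset \<psi> Y \<longleftrightarrow> (\<forall>c. grade_count \<phi> X c = grade_count \<psi> Y c)"
  unfolding grade_count_def multiset_eq_iff by auto

lemma grade_difference_in_kernel_grades:
  assumes X: "set_mset X \<subseteq> {..<dim_col B}" and Y: "set_mset Y \<subseteq> {..<dim_col B}"
    and same: "same_image B X Y"
  shows "(\<lambda>c. grade_count \<phi> Y c - grade_count \<phi> X c) \<in> kernel_grades (B, \<phi>)"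
  unfolding kernel_grades_def mem_Collect_eq
proof (intro exI[of _ "\<lambda>x. int (count Y x) - int (count X x)"] conjI allI impI)
  fix k assume "k < dim_row (fst (B, \<phi>))"
  then have "(\<Sum>x\<in>#X. B $$ (k, x)) = (\<Sum>x\<in>#Y. B $$ (k, x))"
    using same by (simp add: same_image_def)
  then show "(\<Sum>x<dim_col (fst (B, \<phi>)). fst (B, \<phi>) $$ (k, x) * (int (count Y x) - int (count X x))) = 0"
    unfolding sum_mset_eq_sum_count[OF X] sum_mset_eq_sum_count[OF Y]
    by (simp add: right_diff_distrib sum_subtractf)
qed (simp add: grade_count_eq_sum[OF X] grade_count_eq_sum[OF Y] sum_subtractf)

lemma kernel_grades_support:
  assumes "g \<in> kernel_grades (B, \<phi>)" "\<And>x. x < dim_col B \<Longrightarrow> \<phi> x < t" "t \<le> c"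
  shows "g c = 0"
proof -
  have "{x. x < dim_col B \<and> \<phi> x = c} = {}" using assms(3) by (auto dest!: assms(2))
  moreover obtain z where "g = (\<lambda>c. \<Sum>x | x < dim_col B \<and> \<phi> x = c. z x)"
    using assms(1) unfolding kernel_grades_def by auto
  ultimately show ?thesis by (simp only: sum.empty)
qed

text \<open>
  Dickson's lemma for pairs of multisets: the minimal pairs are finite in number.
\<close>

lemma bounded_subpairs:
  fixes S :: "(nat multiset \<times> nat multiset) set"
  assumes S: "\<And>X Y. (X, Y) \<in> S \<Longrightarrow> set_mset X \<subseteq> {..<n} \<and> set_mset Y \<subseteq> {..<n}"
  shows "\<exists>D. \<forall>X Y. (X, Y) \<in> S \<longrightarrow>
    (\<exists>P P'. (P, P') \<in> S \<and> P \<subseteq># X \<and> P' \<subseteq># Y \<and> size P \<le> D \<and> size P' \<le> D)"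
proof -
  define w where "w = (\<lambda>(X, Y) (x :: nat, b). count (if b then Y else X :: nat multiset) x)"
  have "finite ({..<n} \<times> (UNIV :: bool set))" by simp
  from dickson[OF this, of S w] obtain E where E: "E \<subseteq> S" "finite E"
    "\<forall>p\<in>S. \<exists>p'\<in>E. \<forall>k\<in>{..<n} \<times> UNIV. w p' k \<le> w p k" by blast
  define D where "D = (\<Sum>(P, P')\<in>E. size P + size P')"
  have D: "size P + size P' \<le> D" if "(P, P') \<in> E" for P P'
    unfolding D_def using member_le_sum[OF that, of "\<lambda>(P, P'). size P + size P'"] E(2) by auto
  show ?thesis
  proof (intro exI[of _ D] allI impI)
    fix X Y assume XY: "(X, Y) \<in> S"
    then obtain P P' where P: "(P, P') \<in> E" "\<forall>k\<in>{..<n} \<times> UNIV. w (P, P') k \<le> w (X, Y) k"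
      using E(3) by fast
    have PS: "(P, P') \<in> S" using P(1) E(1) by blast
    have le: "count P x \<le> count X x" "count P' x \<le> count Y x" if "x < n" for x
      using P(2)[rule_format, of "(x, False)"] P(2)[rule_format, of "(x, True)"] that
      by (auto simp: w_def)
    have zero: "count P x = 0" "count P' x = 0" if "\<not> x < n" for x
      using S[OF PS] that by (auto simp flip: not_in_iff)
    have "P \<subseteq># X" "P' \<subseteq># Y"
      using le zero by (metis le0 mset_subset_eqI)+
    then show "\<exists>P P'. (P, P') \<in> S \<and> P \<subseteq># X \<and> P' \<subseteq># Y \<and> size P \<le> D \<and> size P' \<le> D"
      using PS D[OF P(1)] by (intro exI[of _ P] exI[of _ P']) simp
  qed
qed

text \<open>
  A finite set of nonzero elements with a weak form of the property of a Graver basis: every nonzero element \<open>d\<close> of \<open>L\<close>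
  dominates one of its members, with respect to the positive and negative parts of the values of all
  functionals in \<open>H\<close>.
\<close>

lemma conformal_generators:
  fixes L H :: "(nat \<Rightarrow> int) set"
  assumes "finite H"
  shows "\<exists>E\<subseteq>L - {\<lambda>_. 0}. finite E \<and> (\<forall>d\<in>L - {\<lambda>_. 0}. \<exists>g\<in>E. \<forall>h\<in>H.
    min 0 (\<Sum>c<t. h c * d c) \<le> (\<Sum>c<t. h c * g c) \<and> (\<Sum>c<t. h c * g c) \<le> max 0 (\<Sum>c<t. h c * d c))"
proof -
  define w where "w d = (\<lambda>(h, b). nat (if b then \<Sum>c<t. h c * d c else - (\<Sum>c<t. h c * d c)))"
    for d :: "nat \<Rightarrow> int"
  have "finite (H \<times> (UNIV :: bool set))" using assms by simp
  from dickson[OF this, of "L - {\<lambda>_. 0}" w] obtain E where E: "E \<subseteq> L - {\<lambda>_. 0}" "finite E"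
    "\<forall>d\<in>L - {\<lambda>_. 0}. \<exists>g\<in>E. \<forall>k\<in>H \<times> UNIV. w g k \<le> w d k" by (elim exE conjE)
  have between: "min 0 b \<le> a \<and> a \<le> max 0 b" if "nat a \<le> nat b" "nat (- a) \<le> nat (- b)" for a b :: int
    using that by linarith
  have dominated: "min 0 (\<Sum>c<t. h c * d c) \<le> (\<Sum>c<t. h c * g c) \<and> (\<Sum>c<t. h c * g c) \<le> max 0 (\<Sum>c<t. h c * d c)"
    if "\<forall>k\<in>H \<times> UNIV. w g k \<le> w d k" "h \<in> H" for d g h
  proof (rule between)
    show "nat (\<Sum>c<t. h c * g c) \<le> nat (\<Sum>c<t. h c * d c)"
      using that(1)[rule_format, of "(h, True)"] that(2) by (simp only: w_def prod.case if_True UNIV_I mem_Sigma_iff)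
    show "nat (- (\<Sum>c<t. h c * g c)) \<le> nat (- (\<Sum>c<t. h c * d c))"
      using that(1)[rule_format, of "(h, False)"] that(2) by (simp only: w_def prod.case if_False UNIV_I mem_Sigma_iff)
  qed
  show ?thesis
  proof (intro exI[of _ E] conjI ballI E(1,2))
    fix d assume "d \<in> L - {\<lambda>_. 0}"
    from E(3)[rule_format, OF this] obtain g
      where g: "g \<in> E" "\<forall>k\<in>H \<times> UNIV. w g k \<le> w d k" by (elim bexE)
    show "\<exists>g\<in>E. \<forall>h\<in>H. min 0 (\<Sum>c<t. h c * d c) \<le> (\<Sum>c<t. h c * g c) \<and>
      (\<Sum>c<t. h c * g c) \<le> max 0 (\<Sum>c<t. h c * d c)"
      by (intro bexI[OF _ g(1)] ballI) (rule dominated[OF g(2)])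
  qed
qed

text \<open>
  A replacement of at most \<open>D\<close> columns of \<open>X\<close> by at most \<open>D\<close> others that keeps the image and
  shifts the grade by \<open>g\<close>.
\<close>

definition bounded_change :: "graded_mat \<Rightarrow> nat \<Rightarrow> (nat \<Rightarrow> int) \<Rightarrow> nat multiset \<Rightarrow> bool" where
  "bounded_change G D g X \<longleftrightarrow> (\<exists>P P'. P \<subseteq># X \<and> set_mset P' \<subseteq> {..<dim_col (fst G)} \<and>
     same_image (fst G) P P' \<and> size P \<le> D \<and> size P' \<le> D \<and>
     (\<forall>c. grade_count (snd G) P' c = grade_count (snd G) P c + g c))"

text \<open>
  A grade difference \<open>d\<close> that is possible for all factors can be approached by a shift \<open>g\<close> that does not
  depend on the vectors, and every factor realizes this same \<open>g\<close> by a bounded change.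
\<close>

definition grade_steps :: "nat \<Rightarrow> graded_mat set \<Rightarrow> nat \<Rightarrow> bool" where
  "grade_steps t I D \<longleftrightarrow> (\<forall>d\<in>\<Inter>(kernel_grades ` I). d \<noteq> (\<lambda>_. 0) \<longrightarrow>
     (\<exists>g. (\<Sum>c<t. \<bar>d c - g c\<bar>) < (\<Sum>c<t. \<bar>d c\<bar>) \<and>
       (\<forall>G\<in>I. \<forall>X Y. set_mset X \<subseteq> {..<dim_col (fst G)} \<longrightarrow> set_mset Y \<subseteq> {..<dim_col (fst G)} \<longrightarrow>
         same_image (fst G) X Y \<longrightarrow>
         (\<forall>c. grade_count (snd G) Y c = grade_count (snd G) X c + d c) \<longrightarrow>
         bounded_change G D g X)))"

text \<open>
  The counterpart for vectors of equal image and equal grade. The last condition excludes the empty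
  change, so that an exchange of \<open>P\<close> for \<open>P'\<close> leaves a strictly smaller pair to be dealt with.
\<close>

definition kernel_steps :: "graded_mat \<Rightarrow> nat \<Rightarrow> bool" where
  "kernel_steps G D \<longleftrightarrow> (\<forall>X Y. set_mset X \<subseteq> {..<dim_col (fst G)} \<longrightarrow>
     set_mset Y \<subseteq> {..<dim_col (fst G)} \<longrightarrow> same_image (fst G) X Y \<longrightarrow>
     image_mset (snd G) X = image_mset (snd G) Y \<longrightarrow> X + Y \<noteq> {#} \<longrightarrow>
     (\<exists>P P'. P \<subseteq># X \<and> P' \<subseteq># Y \<and> same_image (fst G) P P' \<and> image_mset (snd G) P = image_mset (snd G) P' \<and>
        size P \<le> D \<and> size P' \<le> D \<and> P + P' \<noteq> {#}))"

lemma kernel_steps_exist: "\<exists>D. kernel_steps G D"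
proof -
  define S where "S = {(X, Y). set_mset X \<subseteq> {..<dim_col (fst G)} \<and>
     set_mset Y \<subseteq> {..<dim_col (fst G)} \<and> same_image (fst G) X Y \<and>
     image_mset (snd G) X = image_mset (snd G) Y \<and> X + Y \<noteq> {#}}"
  have "set_mset X \<subseteq> {..<dim_col (fst G)} \<and> set_mset Y \<subseteq> {..<dim_col (fst G)}"
    if "(X, Y) \<in> S" for X Y using that by (simp add: S_def)
  from bounded_subpairs[OF this] obtain D where D: "\<forall>X Y. (X, Y) \<in> S \<longrightarrow>
    (\<exists>P P'. (P, P') \<in> S \<and> P \<subseteq># X \<and> P' \<subseteq># Y \<and> size P \<le> D \<and> size P' \<le> D)" by blast
  have "kernel_steps G D"
    unfolding kernel_steps_def
  proof (intro allI impI)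
    fix X Y
    assume "set_mset X \<subseteq> {..<dim_col (fst G)}" "set_mset Y \<subseteq> {..<dim_col (fst G)}"
      "same_image (fst G) X Y" "image_mset (snd G) X = image_mset (snd G) Y" "X + Y \<noteq> {#}"
    then have "(X, Y) \<in> S" by (simp add: S_def)
    then obtain P P' where "(P, P') \<in> S" "P \<subseteq># X" "P' \<subseteq># Y" "size P \<le> D" "size P' \<le> D"
      using D by blast
    then show "\<exists>P P'. P \<subseteq># X \<and> P' \<subseteq># Y \<and> same_image (fst G) P P' \<and>
        image_mset (snd G) P = image_mset (snd G) P' \<and> size P \<le> D \<and> size P' \<le> D \<and> P + P' \<noteq> {#}"
      by (intro exI[of _ P] exI[of _ P']) (simp add: S_def)
  qed
  then show ?thesis ..
qed

lemma kernel_steps_mono: "kernel_steps G D \<Longrightarrow> D \<le> D' \<Longrightarrow> kernel_steps G D'"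
  unfolding kernel_steps_def by (meson le_trans)

lemma bounded_change_mono: "bounded_change G D g X \<Longrightarrow> D \<le> D' \<Longrightarrow> bounded_change G D' g X"
  unfolding bounded_change_def by (meson le_trans)

lemma grade_steps_mono:
  assumes "grade_steps t I D" "D \<le> D'"
  shows "grade_steps t I D'"
  unfolding grade_steps_def
proof (intro ballI impI)
  fix d :: "nat \<Rightarrow> int" assume "d \<in> \<Inter>(kernel_grades ` I)" "d \<noteq> (\<lambda>_. 0)"
  with assms(1)[unfolded grade_steps_def, rule_format, OF this] obtain g
    where g: "(\<Sum>c<t. \<bar>d c - g c\<bar>) < (\<Sum>c<t. \<bar>d c\<bar>)"
      "\<And>G X Y. G \<in> I \<Longrightarrow> set_mset X \<subseteq> {..<dim_col (fst G)} \<Longrightarrow> set_mset Y \<subseteq> {..<dim_col (fst G)} \<Longrightarrow>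
         same_image (fst G) X Y \<Longrightarrow>
         \<forall>c. grade_count (snd G) Y c = grade_count (snd G) X c + d c \<Longrightarrow> bounded_change G D g X"
    by auto
  show "\<exists>g. (\<Sum>c<t. \<bar>d c - g c\<bar>) < (\<Sum>c<t. \<bar>d c\<bar>) \<and>
       (\<forall>G\<in>I. \<forall>X Y. set_mset X \<subseteq> {..<dim_col (fst G)} \<longrightarrow> set_mset Y \<subseteq> {..<dim_col (fst G)} \<longrightarrow>
         same_image (fst G) X Y \<longrightarrow>
         (\<forall>c. grade_count (snd G) Y c = grade_count (snd G) X c + d c) \<longrightarrow>
         bounded_change G D' g X)"
  proof (intro exI[of _ g] conjI ballI allI impI g(1))
    fix G X Y
    assume "G \<in> I" "set_mset X \<subseteq> {..<dim_col (fst G)}" "set_mset Y \<subseteq> {..<dim_col (fst G)}"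
      "same_image (fst G) X Y" "\<forall>c. grade_count (snd G) Y c = grade_count (snd G) X c + d c"
    then show "bounded_change G D' g X" by (rule bounded_change_mono[OF g(2) assms(2)])
  qed
qed

text \<open>
  The finitely many functionals of \<open>normal_interval\<close> for all factors, together with the coordinates of
  the grade, are handed to \<open>conformal_generators\<close>. The coordinates ensure that subtracting a generator
  from \<open>d\<close> brings \<open>d\<close> closer to zero; the others ensure that the grade reached is attained by every
  factor. The vector that attains it may be far away from \<open>X\<close>, but \<open>bounded_subpairs\<close> extracts from
  the pair a bounded change with the same effect on the grade, and there are only finitely many
  combinations of a factor and a generator.
\<close>

lemma grade_steps_exist:
  assumes fin: "finite I" and ne: "I \<noteq> {}"
    and normal: "\<And>B \<phi>. (B, \<phi>) \<in> I \<Longrightarrow> normal_semigroup (augmented_mat t B \<phi>)"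
    and t: "\<And>B \<phi> x. (B, \<phi>) \<in> I \<Longrightarrow> x < dim_col B \<Longrightarrow> \<phi> x < t"
  shows "\<exists>D. grade_steps t I D"
proof -
  define good where "good G H \<longleftrightarrow> finite H \<and>
    (\<forall>X Y g. set_mset X \<subseteq> {..<dim_col (fst G)} \<longrightarrow> set_mset Y \<subseteq> {..<dim_col (fst G)} \<longrightarrow>
      same_image (fst G) X Y \<longrightarrow> g \<in> kernel_grades G \<longrightarrow>
      (\<forall>h\<in>H. min 0 (\<Sum>c<t. h c * (grade_count (snd G) Y c - grade_count (snd G) X c)) \<le> (\<Sum>c<t. h c * g c)) \<longrightarrow>
      (\<exists>Z. set_mset Z \<subseteq> {..<dim_col (fst G)} \<and> same_image (fst G) X Z \<and>
           (\<forall>c. grade_count (snd G) Z c = grade_count (snd G) X c + g c)))"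
    for G :: graded_mat and H :: "(nat \<Rightarrow> int) set"
  have "\<exists>H. good G H" if G: "G \<in> I" for G
  proof -
    obtain B \<phi> where G': "G = (B, \<phi>)" by fastforce
    show ?thesis
      using normal_interval[OF normal[OF G[unfolded G']] t[OF G[unfolded G']]]
      unfolding good_def G' fst_conv snd_conv .
  qed
  then obtain H where H: "\<And>G. G \<in> I \<Longrightarrow> good G (H G)" by metis
  define e :: "nat \<Rightarrow> nat \<Rightarrow> int" where "e i c = (if c = i then 1 else 0)" for i c
  have e: "(\<Sum>c<t. e i c * g c) = g i" if "i < t" for i g
    unfolding e_def using that by (simp add: if_distrib[of "\<lambda>u. u * _"] cong: if_cong)
  define HH where "HH = (\<Union>G\<in>I. H G) \<union> e ` {..<t}"
  have finHH: "finite HH" unfolding HH_def using fin H by (auto simp: good_def)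
  define L where "L = \<Inter>(kernel_grades ` I)"
  obtain E where E: "E \<subseteq> L - {\<lambda>_. 0}" "finite E"
    "\<And>d. d \<in> L - {\<lambda>_. 0} \<Longrightarrow> \<exists>g\<in>E. \<forall>h\<in>HH.
      min 0 (\<Sum>c<t. h c * d c) \<le> (\<Sum>c<t. h c * g c) \<and> (\<Sum>c<t. h c * g c) \<le> max 0 (\<Sum>c<t. h c * d c)"
    using conformal_generators[OF finHH, of L t] by blast
  define S where "S = (\<lambda>(G, g). {(X, Y). set_mset X \<subseteq> {..<dim_col (fst G)} \<and>
     set_mset Y \<subseteq> {..<dim_col (fst G)} \<and> same_image (fst G) X Y \<and>
     (\<forall>c. grade_count (snd G) Y c = grade_count (snd G) X c + g c)})"
  define bound where "bound p D \<longleftrightarrow> (\<forall>X Y. (X, Y) \<in> S p \<longrightarrow>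
    (\<exists>P P'. (P, P') \<in> S p \<and> P \<subseteq># X \<and> P' \<subseteq># Y \<and> size P \<le> D \<and> size P' \<le> D))" for p D
  have "\<exists>D. bound p D" for p
    unfolding bound_def
    by (rule bounded_subpairs[where n = "dim_col (fst (fst p))"]) (auto simp: S_def split: prod.splits)
  then obtain \<delta> where \<delta>: "\<And>p. bound p (\<delta> p)" by metis
  define D where "D = (\<Sum>p\<in>I \<times> E. \<delta> p)"
  have D: "\<delta> (G, g) \<le> D" if "G \<in> I" "g \<in> E" for G g
    unfolding D_def using that fin E(2) by (intro member_le_sum) auto
  have "grade_steps t I D"
    unfolding grade_steps_def
  proof (intro ballI impI)
    fix d :: "nat \<Rightarrow> int" assume d: "d \<in> \<Inter>(kernel_grades ` I)" "d \<noteq> (\<lambda>_. 0)"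
    then obtain g where g: "g \<in> E" "\<And>h. h \<in> HH \<Longrightarrow>
      min 0 (\<Sum>c<t. h c * d c) \<le> (\<Sum>c<t. h c * g c) \<and> (\<Sum>c<t. h c * g c) \<le> max 0 (\<Sum>c<t. h c * d c)"
      using E(3)[of d] unfolding L_def by auto
    have gL: "g \<in> kernel_grades G" if "G \<in> I" for G using g(1) E(1) that by (auto simp: L_def)
    have between: "min 0 (d c) \<le> g c \<and> g c \<le> max 0 (d c)" if "c < t" for c
      using g(2)[of "e c"] that e[OF that] by (auto simp: HH_def)
    have le: "\<bar>d c - g c\<bar> + \<bar>g c\<bar> = \<bar>d c\<bar>" if "c < t" for c
      using between[OF that] by linarith
    have "g \<noteq> (\<lambda>_. 0)" using g(1) E(1) by auto
    then obtain c0 where c0: "g c0 \<noteq> 0" by auto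
    obtain B \<phi> where "(B, \<phi>) \<in> I" using ne by auto
    then have "c0 < t" using kernel_grades_support[OF gL t] c0 by (meson not_le)
    have less: "(\<Sum>c<t. \<bar>d c - g c\<bar>) < (\<Sum>c<t. \<bar>d c\<bar>)"
    proof (rule sum_strict_mono_ex1)
      show "\<forall>c\<in>{..<t}. \<bar>d c - g c\<bar> \<le> \<bar>d c\<bar>" using le by force
      show "\<exists>c\<in>{..<t}. \<bar>d c - g c\<bar> < \<bar>d c\<bar>"
        using le[OF \<open>c0 < t\<close>] c0 \<open>c0 < t\<close> by (intro bexI[of _ c0]) auto
    qed simp
    have "bounded_change G D g X" if G: "G \<in> I"
      and X: "set_mset X \<subseteq> {..<dim_col (fst G)}" and Y: "set_mset Y \<subseteq> {..<dim_col (fst G)}"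
      and XY: "same_image (fst G) X Y" and grade: "\<forall>c. grade_count (snd G) Y c = grade_count (snd G) X c + d c"
      for G X Y
    proof -
      have "\<forall>h\<in>H G. min 0 (\<Sum>c<t. h c * (grade_count (snd G) Y c - grade_count (snd G) X c)) \<le> (\<Sum>c<t. h c * g c)"
      proof
        fix h assume "h \<in> H G"
        then have "h \<in> HH" using G by (auto simp: HH_def)
        then show "min 0 (\<Sum>c<t. h c * (grade_count (snd G) Y c - grade_count (snd G) X c)) \<le> (\<Sum>c<t. h c * g c)"
          using g(2)[of h] grade by simp
      qed
      then obtain Z where Z: "set_mset Z \<subseteq> {..<dim_col (fst G)}" "same_image (fst G) X Z"
          "\<forall>c. grade_count (snd G) Z c = grade_count (snd G) X c + g c"
        using H[OF G] X Y XY gL[OF G] unfolding good_def by blast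
      then have "(X, Z) \<in> S (G, g)" using X by (simp add: S_def)
      then obtain P P' where "(P, P') \<in> S (G, g)" "P \<subseteq># X" "size P \<le> \<delta> (G, g)" "size P' \<le> \<delta> (G, g)"
        using \<delta>[of "(G, g)"] unfolding bound_def by blast
      then show ?thesis
        using D[OF G g(1)] unfolding S_def bounded_change_def
        by (intro exI[of _ P] exI[of _ P']) auto
    qed
    with less show "\<exists>g. (\<Sum>c<t. \<bar>d c - g c\<bar>) < (\<Sum>c<t. \<bar>d c\<bar>) \<and>
       (\<forall>G\<in>I. \<forall>X Y. set_mset X \<subseteq> {..<dim_col (fst G)} \<longrightarrow> set_mset Y \<subseteq> {..<dim_col (fst G)} \<longrightarrow>
         same_image (fst G) X Y \<longrightarrow>
         (\<forall>c. grade_count (snd G) Y c = grade_count (snd G) X c + d c) \<longrightarrow>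
         bounded_change G D g X)"
      by (intro exI[of _ g] conjI ballI allI impI)
  qed
  then show ?thesis ..
qed

section \<open>The structure of a toric fiber product\<close>

text \<open>
  What the proof uses about a toric fiber product \<open>G\<close> of the family \<open>F\<close>: column \<open>q\<close> is assembled from
  the columns \<open>f q j\<close> of the factors, all tuples of columns of equal grade occur, and the rows are
  those of the factors. Stating this for an arbitrary index set \<open>J\<close> makes products of products
  instances of the same notion, without reassociating matrices.
\<close>

locale fiber_product =
  fixes G :: graded_mat and J :: "'j set" and F :: "'j \<Rightarrow> graded_mat" and f :: "nat \<Rightarrow> 'j \<Rightarrow> nat"
  assumes finite_factors: "finite J" and factors_nonempty: "J \<noteq> {}"
    and component_col: "\<And>q j. q < dim_col (fst G) \<Longrightarrow> j \<in> J \<Longrightarrow> f q j < dim_col (fst (F j))"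
    and component_grade: "\<And>q j. q < dim_col (fst G) \<Longrightarrow> j \<in> J \<Longrightarrow> snd (F j) (f q j) = snd G q"
    and tuple_col: "\<And>y c. (\<And>j. j \<in> J \<Longrightarrow> y j < dim_col (fst (F j)) \<and> snd (F j) (y j) = c) \<Longrightarrow>
      \<exists>q<dim_col (fst G). \<forall>j\<in>J. f q j = y j"
    and row_from_factor: "\<And>i. i < dim_row (fst G) \<Longrightarrow>
      \<exists>j\<in>J. \<exists>k<dim_row (fst (F j)). \<forall>q<dim_col (fst G). fst G $$ (i, q) = fst (F j) $$ (k, f q j)"
    and row_of_factor: "\<And>j k. j \<in> J \<Longrightarrow> k < dim_row (fst (F j)) \<Longrightarrow>
      \<exists>i<dim_row (fst G). \<forall>q<dim_col (fst G). fst G $$ (i, q) = fst (F j) $$ (k, f q j)"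

lemma fiber_product_compose:
  assumes outer: "fiber_product G P E e"
    and inner: "\<And>p. p \<in> P \<Longrightarrow> fiber_product (E p) (J p) (F p) (f p)"
  shows "fiber_product G (Sigma P J) (\<lambda>(p, l). F p l) (\<lambda>q (p, l). f p (e q p) l)"
proof -
  interpret O: fiber_product G P E e by (rule outer)
  show ?thesis
  proof (unfold_locales, goal_cases)
    case 1
    show ?case using O.finite_factors fiber_product.finite_factors[OF inner] by auto
  next
    case 2
    show ?case using O.factors_nonempty fiber_product.factors_nonempty[OF inner] by auto
  next
    case (3 q j)
    then show ?case
      using O.component_col fiber_product.component_col[OF inner] by (auto split: prod.splits)
  next
    case (4 q j)
    then show ?case
      using O.component_col O.component_grade fiber_product.component_grade[OF inner]
      by (auto split: prod.splits)
  next
    case (5 y c)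
    have "\<exists>m<dim_col (fst (E p)). snd (E p) m = c \<and> (\<forall>l\<in>J p. f p m l = y (p, l))" if p: "p \<in> P" for p
    proof -
      interpret I: fiber_product "E p" "J p" "F p" "f p" by (rule inner[OF p])
      have y: "y (p, l) < dim_col (fst (F p l)) \<and> snd (F p l) (y (p, l)) = c" if "l \<in> J p" for l
        using 5[of "(p, l)"] p that by simp
      from I.tuple_col[of "\<lambda>l. y (p, l)" c] y obtain m
        where m: "m < dim_col (fst (E p))" "\<forall>l\<in>J p. f p m l = y (p, l)" by blast
      obtain l where l: "l \<in> J p" using I.factors_nonempty by blast
      have "snd (E p) m = c" using I.component_grade[OF m(1) l] m(2) l y[OF l] by simp
      with m show ?thesis by blast
    qed
    then obtain m where m: "\<And>p. p \<in> P \<Longrightarrow> m p < dim_col (fst (E p)) \<and> snd (E p) (m p) = c \<and>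
        (\<forall>l\<in>J p. f p (m p) l = y (p, l))" by metis
    obtain q where "q < dim_col (fst G)" "\<forall>p\<in>P. e q p = m p"
      using O.tuple_col[of m c] m by blast
    then show ?case using m by (intro exI[of _ q]) auto
  next
    case (6 i)
    obtain p k where p: "p \<in> P" "k < dim_row (fst (E p))"
      "\<forall>q<dim_col (fst G). fst G $$ (i, q) = fst (E p) $$ (k, e q p)"
      using O.row_from_factor[OF 6] by blast
    obtain l k' where l: "l \<in> J p" "k' < dim_row (fst (F p l))"
      "\<forall>q<dim_col (fst (E p)). fst (E p) $$ (k, q) = fst (F p l) $$ (k', f p q l)"
      using fiber_product.row_from_factor[OF inner[OF p(1)] p(2)] by blast
    show ?case using p l O.component_col
      by (intro bexI[of _ "(p, l)"]) (auto intro!: exI[of _ k'])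
  next
    case (7 j k)
    obtain p l where j: "j = (p, l)" "p \<in> P" "l \<in> J p" using 7 by auto
    obtain k' where k': "k' < dim_row (fst (E p))"
      "\<forall>q<dim_col (fst (E p)). fst (E p) $$ (k', q) = fst (F p l) $$ (k, f p q l)"
      using fiber_product.row_of_factor[OF inner[OF j(2)] j(3)] 7 j by auto
    obtain i where "i < dim_row (fst G)" "\<forall>q<dim_col (fst G). fst G $$ (i, q) = fst (E p) $$ (k', e q p)"
      using O.row_of_factor[OF j(2) k'(1)] by blast
    then show ?case using k' j O.component_col by (intro exI[of _ i]) auto
  qed
qed

lemma tfp_column_Nil: "tfp_column [] [] = vNil"
  by (simp add: tfp_column_def)

lemma tfp_column_Cons: "tfp_column (C # Cs) (i # is) = col (fst C) i @\<^sub>v tfp_column Cs is"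
  by (simp add: tfp_column_def split: prod.splits)

lemma dim_tfp_column:
  "length is = length Cs \<Longrightarrow> dim_vec (tfp_column Cs is) = sum_list (map (\<lambda>(C, \<chi>). dim_row C) Cs)"
  by (induction "is" Cs rule: list_induct2) (auto simp: tfp_column_Nil tfp_column_Cons split: prod.splits)

definition compatible_tuple :: "graded_mat list \<Rightarrow> nat list \<Rightarrow> bool" where
  "compatible_tuple Cs is \<longleftrightarrow> length is = length Cs \<and> (\<forall>j<length Cs. is ! j < dim_col (fst (Cs ! j)))"

lemma tfp_column_row_from_factor:
  assumes "i < sum_list (map (\<lambda>(C, \<chi>). dim_row C) Cs)"
  shows "\<exists>j<length Cs. \<exists>k<dim_row (fst (Cs ! j)). \<forall>is. compatible_tuple Cs is \<longrightarrow>
    tfp_column Cs is $ i = fst (Cs ! j) $$ (k, is ! j)"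
  using assms
proof (induction Cs arbitrary: i)
  case (Cons C Cs)
  show ?case
  proof (cases "i < dim_row (fst C)")
    case True
    have "tfp_column (C # Cs) is $ i = fst C $$ (i, is ! 0)" if "compatible_tuple (C # Cs) is" for "is"
    proof -
      from that obtain a as where "is = a # as" "a < dim_col (fst C)"
        unfolding compatible_tuple_def by (cases "is") auto
      with True show ?thesis by (simp add: tfp_column_Cons)
    qed
    with True show ?thesis by (intro exI[of _ 0]) auto
  next
    case False
    then have "i - dim_row (fst C) < sum_list (map (\<lambda>(C, \<chi>). dim_row C) Cs)"
      using Cons.prems by (cases C) auto
    from Cons.IH[OF this] obtain j k where jk: "j < length Cs" "k < dim_row (fst (Cs ! j))"
      "\<forall>is. compatible_tuple Cs is \<longrightarrow>
        tfp_column Cs is $ (i - dim_row (fst C)) = fst (Cs ! j) $$ (k, is ! j)" by blast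
    have "tfp_column (C # Cs) is $ i = fst (Cs ! j) $$ (k, is ! Suc j)"
      if c: "compatible_tuple (C # Cs) is" for "is"
    proof -
      from c obtain a as where a: "is = a # as" "length as = length Cs"
        unfolding compatible_tuple_def by (cases "is") auto
      have "compatible_tuple Cs as" using c a unfolding compatible_tuple_def by force
      moreover have "i < dim_row (fst C) + dim_vec (tfp_column Cs as)"
        using Cons.prems dim_tfp_column[OF a(2)] by (cases C) auto
      ultimately show ?thesis using jk(3) False a by (simp add: tfp_column_Cons)
    qed
    with jk show ?thesis by (intro exI[of _ "Suc j"]) auto
  qed
qed simp

lemma tfp_column_row_of_factor:
  assumes "j < length Cs" "k < dim_row (fst (Cs ! j))"
  shows "\<exists>i<sum_list (map (\<lambda>(C, \<chi>). dim_row C) Cs). \<forall>is. compatible_tuple Cs is \<longrightarrow>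
    tfp_column Cs is $ i = fst (Cs ! j) $$ (k, is ! j)"
  using assms
proof (induction Cs arbitrary: j)
  case (Cons C Cs)
  show ?case
  proof (cases j)
    case 0
    have "tfp_column (C # Cs) is $ k = fst C $$ (k, is ! 0)" if "compatible_tuple (C # Cs) is" for "is"
    proof -
      from that obtain a as where "is = a # as" "a < dim_col (fst C)"
        unfolding compatible_tuple_def by (cases "is") auto
      with 0 Cons.prems show ?thesis by (simp add: tfp_column_Cons)
    qed
    with 0 Cons.prems show ?thesis by (intro exI[of _ k]) (auto split: prod.splits)
  next
    case (Suc l)
    obtain i where i: "i < sum_list (map (\<lambda>(C, \<chi>). dim_row C) Cs)"
      "\<forall>is. compatible_tuple Cs is \<longrightarrow> tfp_column Cs is $ i = fst (Cs ! l) $$ (k, is ! l)"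
      using Cons.IH[of l] Cons.prems Suc by auto
    have "tfp_column (C # Cs) is $ (dim_row (fst C) + i) = fst (Cs ! l) $$ (k, is ! Suc l)"
      if c: "compatible_tuple (C # Cs) is" for "is"
    proof -
      from c obtain a as where a: "is = a # as" "length as = length Cs"
        unfolding compatible_tuple_def by (cases "is") auto
      have "compatible_tuple Cs as" using c a unfolding compatible_tuple_def by force
      then show ?thesis using i a dim_tfp_column[OF a(2)] by (simp add: tfp_column_Cons)
    qed
    with i Suc show ?thesis
      by (intro exI[of _ "dim_row (fst C) + i"]) (auto split: prod.splits)
  qed
qed simp

lemma set_tfp_tuples:
  "is \<in> set (tfp_tuples Cs) \<longleftrightarrow>
     compatible_tuple Cs is \<and> (\<exists>c. \<forall>j<length Cs. snd (Cs ! j) (is ! j) = c)"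
proof -
  have "list_all2 (\<lambda>x ys. x \<in> set ys) is (map (\<lambda>(C, \<chi>). [0..<dim_col C]) Cs) \<longleftrightarrow> compatible_tuple Cs is"
    unfolding compatible_tuple_def list_all2_conv_all_nth by (auto simp: split_beta)
  then show ?thesis unfolding tfp_tuples_def by (simp add: product_lists_set)
qed

lemma fiber_product_toric_fiber_product:
  assumes "Cs \<noteq> []"
  shows "fiber_product (toric_fiber_product Cs) {..<length Cs} ((!) Cs) (\<lambda>q j. tfp_tuples Cs ! q ! j)"
proof -
  define T where "T = tfp_tuples Cs"
  define M where "M = fst (toric_fiber_product Cs)"
  have dM: "dim_row M = sum_list (map (\<lambda>(C, \<chi>). dim_row C) Cs)" "dim_col M = length T"
    unfolding M_def T_def toric_fiber_product_def by auto
  have entry: "M $$ (i, q) = tfp_column Cs (T ! q) $ i" if "i < dim_row M" "q < dim_col M" for i q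
    using that dM unfolding M_def T_def toric_fiber_product_def by (simp add: mat_of_cols_index)
  have T: "compatible_tuple Cs (T ! q)" "\<exists>c. \<forall>j<length Cs. snd (Cs ! j) (T ! q ! j) = c"
    if "q < dim_col M" for q
    using that dM set_tfp_tuples[of "T ! q" Cs] by (auto simp: T_def)
  show ?thesis
  proof (unfold_locales, unfold M_def[symmetric] T_def[symmetric], goal_cases)
    case (3 q j)
    then show ?case using T(1) by (auto simp: compatible_tuple_def)
  next
    case (4 q j)
    have "snd (toric_fiber_product Cs) q = snd (Cs ! 0) (T ! q ! 0)"
      unfolding T_def toric_fiber_product_def by simp
    then show ?case using T(2)[OF 4(1)] 4(2) assms by auto
  next
    case (5 y c)
    then have "map y [0..<length Cs] \<in> set T"
      unfolding T_def set_tfp_tuples compatible_tuple_def by auto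
    then obtain q where "q < length T" "T ! q = map y [0..<length Cs]"
      by (auto simp: in_set_conv_nth)
    then show ?case using dM by (intro exI[of _ q]) auto
  next
    case (6 i)
    from tfp_column_row_from_factor[OF 6[unfolded dM]] obtain j k
      where "j < length Cs" "k < dim_row (fst (Cs ! j))"
        "\<forall>is. compatible_tuple Cs is \<longrightarrow> tfp_column Cs is $ i = fst (Cs ! j) $$ (k, is ! j)" by blast
    with 6 show ?case using T(1) entry by (intro bexI[of _ j] exI[of _ k]) auto
  next
    case (7 j k)
    then have "j < length Cs" by simp
    from tfp_column_row_of_factor[OF this 7(2)] obtain i where "i < dim_row M"
        "\<forall>is. compatible_tuple Cs is \<longrightarrow> tfp_column Cs is $ i = fst (Cs ! j) $$ (k, is ! j)"
      unfolding dM by blast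
    then show ?case using T(1) entry by (intro exI[of _ i]) auto
  qed (use assms in auto)
qed

section \<open>Moves between tables\<close>

lemma image_mset_submset:
  assumes "E \<subseteq># image_mset g X"
  shows "\<exists>R. R \<subseteq># X \<and> image_mset g R = E"
proof -
  obtain D where "image_mset g X = E + D" using assms by (auto simp: mset_subset_eq_exists_conv)
  then obtain R S where "X = R + S" "image_mset g R = E" using image_mset_eq_plusD[of g X E D] by blast
  then show ?thesis by (intro exI[of _ R]) auto
qed

context fiber_product
begin

abbreviation "Q \<equiv> {..<dim_col (fst G)}"

text \<open>
  A table is a multiset of columns of the product, that is, of compatible tuples. Two tables lie in the
  same fiber iff they are equivalent, and \<open>move C\<close> exchanges at most \<open>C\<close> tuples within a fiber.
\<close>

definition marginal :: "'j \<Rightarrow> nat multiset \<Rightarrow> nat multiset" where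
  "marginal j U = image_mset (\<lambda>q. f q j) U"

definition table :: "nat multiset \<Rightarrow> bool" where
  "table U \<longleftrightarrow> set_mset U \<subseteq> Q"

definition equivalent :: "nat multiset \<Rightarrow> nat multiset \<Rightarrow> bool" where
  "equivalent U V \<longleftrightarrow> (\<forall>j\<in>J. same_image (fst (F j)) (marginal j U) (marginal j V))"

definition move :: "nat \<Rightarrow> nat multiset \<Rightarrow> nat multiset \<Rightarrow> bool" where
  "move C U V \<longleftrightarrow> table U \<and> table V \<and>
     (\<exists>W T T'. U = W + T \<and> V = W + T' \<and> size T \<le> C \<and> size T' \<le> C \<and> equivalent T T')"

lemma moveI:
  assumes "table (W + T)" "table (W + T')" "size T \<le> C" "size T' \<le> C" "equivalent T T'"
  shows "move C (W + T) (W + T')"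
  unfolding move_def using assms by blast

lemma marginal_simps [simp]:
  "marginal j {#} = {#}" "marginal j (add_mset q U) = add_mset (f q j) (marginal j U)"
  "marginal j (U + V) = marginal j U + marginal j V" "size (marginal j U) = size U"
  unfolding marginal_def by auto

lemma table_simps [simp]:
  "table {#}" "table (add_mset q U) \<longleftrightarrow> q \<in> Q \<and> table U" "table (U + V) \<longleftrightarrow> table U \<and> table V"
  unfolding table_def by auto

lemma marginal_cols: "table U \<Longrightarrow> j \<in> J \<Longrightarrow> set_mset (marginal j U) \<subseteq> {..<dim_col (fst (F j))}"
  unfolding table_def marginal_def using component_col by auto

lemma marginal_grades:
  assumes "table U" "j \<in> J"
  shows "image_mset (snd (F j)) (marginal j U) = image_mset (snd G) U"
  unfolding marginal_def image_mset.compositionality comp_def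
  using assms component_grade by (intro image_mset_cong) (auto simp: table_def)

lemma same_image_refl: "same_image B X X"
  unfolding same_image_def by simp

lemma equivalentI_marginals: "(\<And>j. j \<in> J \<Longrightarrow> marginal j U = marginal j V) \<Longrightarrow> equivalent U V"
  unfolding equivalent_def same_image_def by simp

lemma move_table: "move C U V \<Longrightarrow> table U \<and> table V"
  unfolding move_def by simp

lemma move_add: "move C U V \<Longrightarrow> table W \<Longrightarrow> move C (W + U) (W + V)"
  unfolding move_def by (metis add.assoc table_simps(3))

lemma moves_table: "(move C)\<^sup>*\<^sup>* U V \<Longrightarrow> table U \<Longrightarrow> table V"
  by (induction rule: rtranclp_induct) (auto dest: move_table)

lemma moves_add: "(move C)\<^sup>*\<^sup>* U V \<Longrightarrow> table W \<Longrightarrow> (move C)\<^sup>*\<^sup>* (W + U) (W + V)"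
  by (induction rule: rtranclp_induct) (auto dest: move_add intro: rtranclp.rtrancl_into_rtrancl)

lemma move_equivalent: "move C U V \<Longrightarrow> equivalent U V"
  unfolding move_def equivalent_def same_image_def by auto

lemma equivalent_trans: "equivalent U V \<Longrightarrow> equivalent V W \<Longrightarrow> equivalent U W"
  unfolding equivalent_def same_image_def by auto

lemma equivalent_sym: "equivalent U V \<Longrightarrow> equivalent V U"
  unfolding equivalent_def same_image_def by auto

lemma moves_equivalent: "(move C)\<^sup>*\<^sup>* U V \<Longrightarrow> equivalent U V"
  by (induction rule: rtranclp_induct)
     (auto dest: move_equivalent intro: equivalent_trans equivalentI_marginals)

text \<open>
  Vectors of the factors with a common grade can be glued: tuples are formed grade by grade, since all
  these vectors contain equally many columns of each grade.
\<close>

lemma table_with_marginals: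
  assumes "\<And>j. j \<in> J \<Longrightarrow> set_mset (X j) \<subseteq> {..<dim_col (fst (F j))}"
    and "\<And>j. j \<in> J \<Longrightarrow> image_mset (snd (F j)) (X j) = a"
  shows "\<exists>U. table U \<and> (\<forall>j\<in>J. marginal j U = X j)"
  using assms
proof (induction a arbitrary: X)
  case empty
  then show ?case by (intro exI[of _ "{#}"]) auto
next
  case (add c a)
  have "\<exists>x R. X j = add_mset x R \<and> snd (F j) x = c \<and> image_mset (snd (F j)) R = a" if "j \<in> J" for j
    using msed_map_invR[OF add.prems(2)[OF that]] by blast
  then obtain x R where R: "\<And>j. j \<in> J \<Longrightarrow>
      X j = add_mset (x j) (R j) \<and> snd (F j) (x j) = c \<and> image_mset (snd (F j)) (R j) = a" by metis
  have "\<exists>U. table U \<and> (\<forall>j\<in>J. marginal j U = R j)"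
    using add.prems(1) R by (intro add.IH) auto
  then obtain U where U: "table U" "\<forall>j\<in>J. marginal j U = R j" by blast
  have "\<exists>q<dim_col (fst G). \<forall>j\<in>J. f q j = x j"
    using add.prems(1) R by (intro tuple_col[of x c]) fastforce
  then obtain q where "q < dim_col (fst G)" "\<forall>j\<in>J. f q j = x j" by blast
  with U R show ?case by (intro exI[of _ "add_mset q U"]) auto
qed

text \<open>
  A tuple whose components occur in the marginals of \<open>U\<close> can be created in \<open>U\<close> by swapping, one
  component after the other, the entries of two rows of the same grade.
\<close>

lemma swap_to_tuple:
  assumes "v < dim_col (fst G)" "table U" "\<And>j. j \<in> J \<Longrightarrow> f v j \<in># marginal j U" "K \<subseteq> J" "2 \<le> C"
  shows "\<exists>U' u. (move C)\<^sup>*\<^sup>* U U' \<and> u \<in># U' \<and> snd G u = snd G v \<and> (\<forall>j\<in>K. f u j = f v j) \<and>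
    (\<forall>j\<in>J. marginal j U' = marginal j U)"
proof -
  have "finite K" using assms(4) finite_factors finite_subset by blast
  then show ?thesis using \<open>K \<subseteq> J\<close>
  proof (induction K rule: finite_induct)
    case empty
    obtain j where j: "j \<in> J" using factors_nonempty by blast
    obtain u where u: "u \<in># U" "f u j = f v j" using assms(3)[OF j] by (auto simp: marginal_def)
    have "u < dim_col (fst G)" using u(1) assms(2) by (auto simp: table_def)
    then have "snd G u = snd G v" using component_grade[OF _ j] u(2) assms(1) by metis
    then show ?case using u by blast
  next
    case (insert i K)
    then obtain U' u where U': "(move C)\<^sup>*\<^sup>* U U'" "u \<in># U'" "snd G u = snd G v"
      "\<forall>j\<in>K. f u j = f v j" "\<forall>j\<in>J. marginal j U' = marginal j U" by auto
    have i: "i \<in> J" using insert.prems by simp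
    have tU': "table U'" using moves_table[OF U'(1) assms(2)] .
    have "f v i \<in># marginal i U'" using assms(3)[OF i] U'(5) i by simp
    then obtain w where w: "w \<in># U'" "f w i = f v i" by (auto simp: marginal_def)
    show ?case
    proof (cases "u = w")
      case True
      then show ?thesis using U' w by (intro exI[of _ U'] exI[of _ u]) auto
    next
      case False
      then obtain W where W: "U' = W + {#u, w#}"
        using U'(2) w(1) by (metis insert_noteq_member add_mset_add_single mset_add union_mset_add_mset_right empty_neutral(2))
      have u: "u < dim_col (fst G)" and wQ: "w < dim_col (fst G)"
        using tU' W by (auto simp: table_def)
      have "snd G w = snd G v" using component_grade[OF _ i] w(2) wQ assms(1) by metis
      then have gu: "\<And>j. j \<in> J \<Longrightarrow> snd (F j) (f u j) = snd G v" and gw: "\<And>j. j \<in> J \<Longrightarrow> snd (F j) (f w j) = snd G v"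
        using component_grade u wQ U'(3) by auto
      obtain u' where u': "u' < dim_col (fst G)" "\<forall>j\<in>J. f u' j = (if j = i then f w j else f u j)"
      proof -
        have "\<exists>q<dim_col (fst G). \<forall>j\<in>J. f q j = (if j = i then f w j else f u j)"
          by (rule tuple_col[where c = "snd G v"]) (use gu gw component_col u wQ in auto)
        then show thesis using that by blast
      qed
      obtain w' where w': "w' < dim_col (fst G)" "\<forall>j\<in>J. f w' j = (if j = i then f u j else f w j)"
      proof -
        have "\<exists>q<dim_col (fst G). \<forall>j\<in>J. f q j = (if j = i then f u j else f w j)"
          by (rule tuple_col[where c = "snd G v"]) (use gu gw component_col u wQ in auto)
        then show thesis using that by blast
      qed
      have marg: "marginal j {#u', w'#} = marginal j {#u, w#}" if "j \<in> J" for j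
        using u'(2) w'(2) that by (auto simp: add_mset_commute)
      have "move C U' (W + {#u', w'#})"
        unfolding W
      proof (rule moveI)
        show "table (W + {#u', w'#})" using tU' W u'(1) w'(1) by simp
        show "equivalent {#u, w#} {#u', w'#}" using marg by (intro equivalentI_marginals) simp
      qed (use tU' W assms(5) in auto)
      then have "(move C)\<^sup>*\<^sup>* U (W + {#u', w'#})" using U'(1) by simp
      moreover have "snd G u' = snd G v"
        using component_grade[OF u'(1) i] u'(2) i gw[OF i] by simp
      moreover have "\<forall>j\<in>insert i K. f u' j = f v j"
        using u'(2) U'(4) w(2) insert.prems by auto
      moreover have "\<forall>j\<in>J. marginal j (W + {#u', w'#}) = marginal j U"
      proof
        fix j assume j: "j \<in> J"
        have "marginal j (W + {#u', w'#}) = marginal j (W + {#u, w#})"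
          by (simp only: marginal_simps(3) marg[OF j])
        also have "\<dots> = marginal j U" using U'(5) j unfolding W by blast
        finally show "marginal j (W + {#u', w'#}) = marginal j U" .
      qed
      ultimately show ?thesis by (intro exI[of _ "W + {#u', w'#}"] exI[of _ u']) auto
    qed
  qed
qed

text \<open>
  Swapping produces a row that agrees with a given row \<open>v\<close> of \<open>V\<close> in all factors; the remaining rows are
  treated by induction. A last move replaces the row found by \<open>v\<close> itself, since columns are
  not identified with their tuples.
\<close>

lemma moves_equal_marginals:
  assumes "table U" "table V" "\<And>j. j \<in> J \<Longrightarrow> marginal j U = marginal j V" "2 \<le> C"
  shows "(move C)\<^sup>*\<^sup>* U V"
  using assms(1-3)
proof (induction V arbitrary: U)
  case empty
  obtain j where "j \<in> J" using factors_nonempty by blast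
  with empty.prems(3) have "U = {#}" by (metis marginal_simps(1,4) size_eq_0_iff_empty)
  then show ?case by simp
next
  case (add v V)
  have v: "v < dim_col (fst G)" "table V" using add.prems(2) by auto
  obtain U' u where U': "(move C)\<^sup>*\<^sup>* U U'" "u \<in># U'" "\<forall>j\<in>J. f u j = f v j"
      "\<forall>j\<in>J. marginal j U' = marginal j U"
    using swap_to_tuple[OF v(1) add.prems(1) _ subset_refl assms(4)] add.prems(3) by auto
  obtain W where W: "U' = add_mset u W" using U'(2) by (metis mset_add)
  have tU': "table U'" using moves_table[OF U'(1) add.prems(1)] .
  have "move C (W + {#u#}) (W + {#v#})"
  proof (rule moveI)
    show "equivalent {#u#} {#v#}" using U'(3) by (intro equivalentI_marginals) simp
  qed (use tU' W v assms(4) in auto)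
  then have "move C U' (add_mset v W)" unfolding W by simp
  moreover have "(move C)\<^sup>*\<^sup>* W V"
  proof (rule add.IH)
    fix j assume j: "j \<in> J"
    have "add_mset (f u j) (marginal j W) = add_mset (f v j) (marginal j V)"
      using U'(4) add.prems(3)[OF j] j W by simp
    then show "marginal j W = marginal j V" using U'(3) j by simp
  qed (use tU' W v in auto)
  then have "(move C)\<^sup>*\<^sup>* ({#v#} + W) ({#v#} + V)" by (rule moves_add) (use v in simp)
  ultimately show ?case using U'(1) by (simp add: rtranclp_trans)
qed

text \<open>
  Bounded changes of the marginals, made in all factors at once, lift to moves whose size is bounded
  independently of the number of factors. The difficulty is that the grades of the parts \<open>P j\<close> to be
  removed may differ from factor to factor. They are all contained in the part \<open>E\<close> of the grade \<open>a\<close> of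
  the table that is cut off at multiplicity \<open>D\<close>, so each \<open>P j\<close> can be enlarged within the marginal to a
  part of grade exactly \<open>E\<close>. The enlarged parts form a subtable of at most \<open>D t\<close> rows, which swaps
  bring to light and a single move then exchanges.
\<close>

lemma moves_replace_marginals:
  assumes U: "table U"
    and PX: "\<And>j. j \<in> J \<Longrightarrow> P j \<subseteq># marginal j U"
    and P': "\<And>j. j \<in> J \<Longrightarrow> set_mset (P' j) \<subseteq> {..<dim_col (fst (F j))}"
    and img: "\<And>j. j \<in> J \<Longrightarrow> same_image (fst (F j)) (P j) (P' j)"
    and size: "\<And>j. j \<in> J \<Longrightarrow> size (P j) \<le> D" "\<And>j. j \<in> J \<Longrightarrow> size (P' j) \<le> D"
    and grade: "\<And>j. j \<in> J \<Longrightarrow> image_mset (snd (F j)) (marginal j U - P j + P' j) = a'"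
    and t: "\<And>j x. j \<in> J \<Longrightarrow> x < dim_col (fst (F j)) \<Longrightarrow> snd (F j) x < t"
  shows "\<exists>U'. (move (2 + D + D * t))\<^sup>*\<^sup>* U U' \<and> (\<forall>j\<in>J. marginal j U' = marginal j U - P j + P' j)"
proof -
  define a where "a = image_mset (snd G) U"
  have a: "image_mset (snd (F j)) (marginal j U) = a" if "j \<in> J" for j
    using marginal_grades[OF U that] by (simp add: a_def)
  have cols: "set_mset (marginal j U) \<subseteq> {..<dim_col (fst (F j))}" if "j \<in> J" for j
    using marginal_cols[OF U that] .
  \<comment> \<open>A common upper bound of the grades of all \<open>P j\<close>, of size at most \<open>D * t\<close>.\<close>
  define E where "E = a \<inter># (\<Sum>c<t. replicate_mset D c)"
  have Ea: "E \<subseteq># a" unfolding E_def by simp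
  have sE: "size E \<le> D * t"
  proof -
    have "size E \<le> size (\<Sum>c<t. replicate_mset D c)" unfolding E_def by (intro size_mset_mono) simp
    also have "\<dots> = D * t" by (induction t) auto
    finally show ?thesis .
  qed
  have "\<exists>R. R \<subseteq># marginal j U - P j \<and> image_mset (snd (F j)) R + image_mset (snd (F j)) (P j) = E"
    if j: "j \<in> J" for j
  proof -
    let ?p = "image_mset (snd (F j)) (P j)"
    have pa: "?p \<subseteq># a" using image_mset_subseteq_mono[OF PX[OF j]] a[OF j] by metis
    have "?p \<subseteq># (\<Sum>c<t. replicate_mset D c)"
    proof (rule mset_subset_eqI)
      fix c
      show "count ?p c \<le> count (\<Sum>c<t. replicate_mset D c) c"
      proof (cases "c < t")
        case True
        have "count (\<Sum>c<t. replicate_mset D c) c = (\<Sum>i<t. if i = c then D else 0)"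
          unfolding count_sum by (intro sum.cong) auto
        also have "\<dots> = D" using True by simp
        finally show ?thesis using count_le_size[of ?p c] size(1)[OF j] by simp
      next
        case False
        have "c \<notin># ?p"
        proof
          assume "c \<in># ?p"
          then obtain x where "x \<in># P j" "snd (F j) x = c" by auto
          moreover from this have "x < dim_col (fst (F j))"
            using mset_subset_eqD[OF PX[OF j]] cols[OF j] by auto
          ultimately show False using t[OF j] False by auto
        qed
        then show ?thesis unfolding not_in_iff by linarith
      qed
    qed
    with pa have pE: "?p \<subseteq># E" unfolding E_def by simp
    have "E - ?p \<subseteq># a - ?p" using Ea by (simp add: subseteq_mset_def diff_le_mono)
    also have "a - ?p = image_mset (snd (F j)) (marginal j U - P j)"
      using a[OF j] image_mset_Diff[OF PX[OF j]] by metis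
    finally obtain R where "R \<subseteq># marginal j U - P j" "image_mset (snd (F j)) R = E - ?p"
      using image_mset_submset by blast
    then show ?thesis using pE by (intro exI[of _ R]) (simp add: subset_mset.diff_add)
  qed
  then obtain R where R: "\<And>j. j \<in> J \<Longrightarrow> R j \<subseteq># marginal j U - P j"
      "\<And>j. j \<in> J \<Longrightarrow> image_mset (snd (F j)) (R j) + image_mset (snd (F j)) (P j) = E" by metis
  define Y where "Y j = marginal j U - P j - R j" for j
  have XY: "marginal j U = Y j + (R j + P j)" if "j \<in> J" for j
    using R(1)[OF that] PX[OF that] unfolding Y_def
    by (metis add.assoc subset_mset.diff_add)
  have XY': "marginal j U - P j + P' j = Y j + (R j + P' j)" if "j \<in> J" for j
    using XY[OF that] by simp
  have gY: "image_mset (snd (F j)) (Y j) = a - E" if "j \<in> J" for j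
    using a[OF that] R(2)[OF that] unfolding XY[OF that] by auto
  have gZ': "image_mset (snd (F j)) (R j + P' j) = a' - (a - E)" if "j \<in> J" for j
    using grade[OF that] gY[OF that] unfolding XY'[OF that] by auto
  have colsYRP: "set_mset (Y j) \<subseteq> {..<dim_col (fst (F j))}" "set_mset (R j) \<subseteq> {..<dim_col (fst (F j))}"
      "set_mset (P j) \<subseteq> {..<dim_col (fst (F j))}" if "j \<in> J" for j
    using cols[OF that] unfolding XY[OF that] by auto
  obtain W where W: "table W" "\<forall>j\<in>J. marginal j W = Y j"
    using table_with_marginals[of Y "a - E"] colsYRP(1) gY by blast
  obtain T where T: "table T" "\<forall>j\<in>J. marginal j T = R j + P j"
    using table_with_marginals[of "\<lambda>j. R j + P j" E] colsYRP R(2) by auto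
  obtain T' where T': "table T'" "\<forall>j\<in>J. marginal j T' = R j + P' j"
    using table_with_marginals[of "\<lambda>j. R j + P' j" "a' - (a - E)"] colsYRP(2) P' gZ' by auto
  obtain j where j: "j \<in> J" using factors_nonempty by blast
  have sR: "size (R j) + size (P j) \<le> D * t"
    using arg_cong[OF R(2)[OF j], of size] sE by simp
  have "size T = size (R j + P j)" "size T' = size (R j + P' j)"
    using T(2) T'(2) j marginal_simps(4) by metis+
  then have sT: "size T \<le> 2 + D + D * t" "size T' \<le> 2 + D + D * t"
    using sR size(2)[OF j] by auto
  have "(move (2 + D + D * t))\<^sup>*\<^sup>* U (W + T)"
    using U W T XY by (intro moves_equal_marginals) auto
  moreover have "move (2 + D + D * t) (W + T) (W + T')"
  proof (rule moveI)
    show "equivalent T T'"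
      using T(2) T'(2) img unfolding equivalent_def same_image_def by auto
  qed (use W T T' sT in auto)
  ultimately have "(move (2 + D + D * t))\<^sup>*\<^sup>* U (W + T')" by simp
  moreover have "\<forall>j\<in>J. marginal j (W + T') = marginal j U - P j + P' j"
    using W(2) T'(2) XY' by auto
  ultimately show ?thesis by blast
qed

end

context fiber_product
begin

lemma grade_count_marginal:
  assumes "table U" "j \<in> J"
  shows "grade_count (snd (F j)) (marginal j U) = grade_count (snd G) U"
  using marginal_grades[OF assms] by (simp add: grade_count_def fun_eq_iff)

section \<open>Connecting the tables of a fiber\<close>

text \<open>
  The shifts of \<open>grade_steps\<close> are applied to all factors simultaneously, which keeps the marginals
  gradable in common; every step diminishes the distance between the grades of \<open>U\<close> and \<open>V\<close>.
\<close>

lemma moves_to_grade: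
  assumes t: "\<And>j x. j \<in> J \<Longrightarrow> x < dim_col (fst (F j)) \<Longrightarrow> snd (F j) x < t"
    and steps: "grade_steps t (F ` J) D"
    and "table U" "table V" "equivalent U V"
  shows "\<exists>U'. (move (2 + D + D * t))\<^sup>*\<^sup>* U U' \<and> image_mset (snd G) U' = image_mset (snd G) V"
  using assms(3-5)
proof (induction "nat (\<Sum>c<t. \<bar>grade_count (snd G) V c - grade_count (snd G) U c\<bar>)"
    arbitrary: U rule: less_induct)
  case less
  define d where "d c = grade_count (snd G) V c - grade_count (snd G) U c" for c
  show ?case
  proof (cases "d = (\<lambda>_. 0)")
    case True
    then have "image_mset (snd G) U = image_mset (snd G) V"
      unfolding grade_count_eq_iff d_def by (auto simp: fun_eq_iff)
    then show ?thesis by blast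
  next
    case False
    have cols: "set_mset (marginal j U) \<subseteq> {..<dim_col (fst (F j))}"
        "set_mset (marginal j V) \<subseteq> {..<dim_col (fst (F j))}" if "j \<in> J" for j
      using marginal_cols less.prems that by auto
    have same: "same_image (fst (F j)) (marginal j U) (marginal j V)" if "j \<in> J" for j
      using less.prems that by (simp add: equivalent_def)
    have gc: "grade_count (snd (F j)) (marginal j V) c = grade_count (snd (F j)) (marginal j U) c + d c"
      if "j \<in> J" for j c
      using grade_count_marginal less.prems that by (simp add: d_def)
    have "d \<in> kernel_grades (F j)" if "j \<in> J" for j
      using grade_difference_in_kernel_grades[OF cols[OF that] same[OF that], of "snd (F j)"]
      by (simp add: gc[OF that])
    then have dI: "d \<in> \<Inter>(kernel_grades ` F ` J)" by auto
    obtain g where g: "(\<Sum>c<t. \<bar>d c - g c\<bar>) < (\<Sum>c<t. \<bar>d c\<bar>)"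
      "\<And>j X Y. j \<in> J \<Longrightarrow> set_mset X \<subseteq> {..<dim_col (fst (F j))} \<Longrightarrow>
         set_mset Y \<subseteq> {..<dim_col (fst (F j))} \<Longrightarrow> same_image (fst (F j)) X Y \<Longrightarrow>
         (\<forall>c. grade_count (snd (F j)) Y c = grade_count (snd (F j)) X c + d c) \<Longrightarrow>
         bounded_change (F j) D g X"
      using steps[unfolded grade_steps_def, rule_format, OF dI False] by auto
    have "bounded_change (F j) D g (marginal j U)" if j: "j \<in> J" for j
      using g(2)[OF j cols[OF j] same[OF j]] gc[OF j] by blast
    then obtain P P' where P: "\<And>j. j \<in> J \<Longrightarrow> P j \<subseteq># marginal j U \<and> set_mset (P' j) \<subseteq> {..<dim_col (fst (F j))} \<and>
        same_image (fst (F j)) (P j) (P' j) \<and> size (P j) \<le> D \<and> size (P' j) \<le> D \<and>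
        (\<forall>c. grade_count (snd (F j)) (P' j) c = grade_count (snd (F j)) (P j) c + g c)"
      unfolding bounded_change_def by metis
    have gX: "grade_count (snd (F j)) (marginal j U - P j + P' j) c = grade_count (snd G) U c + g c"
      if j: "j \<in> J" for j c
    proof -
      obtain R where R: "marginal j U = P j + R" using P[OF j] by (auto simp: mset_subset_eq_exists_conv)
      then have "grade_count (snd (F j)) (marginal j U - P j + P' j) c =
          grade_count (snd (F j)) (marginal j U) c + g c"
        using P[OF j] by (simp add: grade_count_union)
      then show ?thesis using grade_count_marginal[OF less.prems(1) j] by simp
    qed
    obtain i where i: "i \<in> J" using factors_nonempty by blast
    define a' where "a' = image_mset (snd (F i)) (marginal i U - P i + P' i)"
    have a': "image_mset (snd (F j)) (marginal j U - P j + P' j) = a'" if "j \<in> J" for j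
      unfolding a'_def grade_count_eq_iff using gX[OF that] gX[OF i] by simp
    obtain U1 where U1: "(move (2 + D + D * t))\<^sup>*\<^sup>* U U1"
        "\<forall>j\<in>J. marginal j U1 = marginal j U - P j + P' j"
      using moves_replace_marginals[OF less.prems(1), of P P' D a' t] P a' t by blast
    have tU1: "table U1" using moves_table[OF U1(1) less.prems(1)] .
    have gU1: "grade_count (snd G) U1 c = grade_count (snd G) U c + g c" for c
      using grade_count_marginal[OF tU1 i] gX[OF i] U1(2) i by metis
    have "equivalent U1 V"
      using equivalent_trans[OF equivalent_sym[OF moves_equivalent[OF U1(1)]] less.prems(3)] .
    moreover have "nat (\<Sum>c<t. \<bar>grade_count (snd G) V c - grade_count (snd G) U1 c\<bar>)
        < nat (\<Sum>c<t. \<bar>grade_count (snd G) V c - grade_count (snd G) U c\<bar>)"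
    proof -
      have "(\<Sum>c<t. \<bar>grade_count (snd G) V c - grade_count (snd G) U1 c\<bar>) = (\<Sum>c<t. \<bar>d c - g c\<bar>)"
        unfolding gU1 d_def by (simp add: algebra_simps)
      moreover have "0 \<le> (\<Sum>c<t. \<bar>d c - g c\<bar>)" by (simp add: sum_nonneg)
      ultimately show ?thesis using g(1) unfolding d_def by linarith
    qed
    ultimately obtain U' where "(move (2 + D + D * t))\<^sup>*\<^sup>* U1 U'"
        "image_mset (snd G) U' = image_mset (snd G) V"
      using less.hyps[of U1] tU1 less.prems(2) by blast
    with U1(1) show ?thesis by (meson rtranclp_trans)
  qed
qed

text \<open>
  The part \<open>W\<close> of the marginal collects what has already been exchanged, while \<open>X\<close> and \<open>Y\<close> shrink.
\<close>

lemma moves_one_marginal: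
  assumes t: "\<And>j x. j \<in> J \<Longrightarrow> x < dim_col (fst (F j)) \<Longrightarrow> snd (F j) x < t"
    and i: "i \<in> J" and steps: "kernel_steps (F i) D"
    and "table U" "marginal i U = W + X" "set_mset Y \<subseteq> {..<dim_col (fst (F i))}"
      "same_image (fst (F i)) X Y" "image_mset (snd (F i)) X = image_mset (snd (F i)) Y"
  shows "\<exists>U'. (move (2 + D + D * t))\<^sup>*\<^sup>* U U' \<and> marginal i U' = W + Y \<and>
    (\<forall>j\<in>J - {i}. marginal j U' = marginal j U)"
  using assms(4-)
proof (induction "size X + size Y" arbitrary: U W X Y rule: less_induct)
  case less
  show ?case
  proof (cases "X + Y = {#}")
    case True
    then show ?thesis using less.prems by (intro exI[of _ U]) auto
  next
    case False
    have X: "set_mset X \<subseteq> {..<dim_col (fst (F i))}"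
      using marginal_cols[OF less.prems(1) i] less.prems(2) by simp
    obtain P P' where P: "P \<subseteq># X" "P' \<subseteq># Y" "same_image (fst (F i)) P P'"
        "image_mset (snd (F i)) P = image_mset (snd (F i)) P'" "size P \<le> D" "size P' \<le> D" "P + P' \<noteq> {#}"
      using steps X less.prems(3-5) False unfolding kernel_steps_def by blast
    obtain X1 where X1: "X = P + X1" using P(1) by (auto simp: mset_subset_eq_exists_conv)
    obtain Y1 where Y1: "Y = P' + Y1" using P(2) by (auto simp: mset_subset_eq_exists_conv)
    define p p' where "p j = (if j = i then P else {#})" and "p' j = (if j = i then P' else {#})" for j
    have mi: "marginal i U - p i + p' i = (W + P') + X1"
      unfolding less.prems(2) X1 p_def p'_def by simp
    have gr: "image_mset (snd (F j)) (marginal j U - p j + p' j) = image_mset (snd G) U" if j: "j \<in> J" for j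
    proof (cases "j = i")
      case True
      have "image_mset (snd (F i)) (marginal i U - p i + p' i) = image_mset (snd (F i)) ((W + P') + X1)"
        by (simp only: mi)
      also have "\<dots> = image_mset (snd (F i)) (marginal i U)"
        unfolding less.prems(2) X1 using P(4) by simp
      finally show ?thesis using marginal_grades[OF less.prems(1) i] True by simp
    next
      case False
      then show ?thesis using marginal_grades[OF less.prems(1) j] by (simp add: p_def p'_def)
    qed
    have "\<exists>U'. (move (2 + D + D * t))\<^sup>*\<^sup>* U U' \<and> (\<forall>j\<in>J. marginal j U' = marginal j U - p j + p' j)"
    proof (rule moves_replace_marginals[OF less.prems(1) _ _ _ _ _ gr t])
      show "p j \<subseteq># marginal j U" for j
        unfolding p_def using less.prems(2) X1 by (auto simp: add.assoc intro: subset_mset.order_trans)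
      show "set_mset (p' j) \<subseteq> {..<dim_col (fst (F j))}" for j
        using less.prems(3) Y1 by (auto simp: p'_def)
      show "same_image (fst (F j)) (p j) (p' j)" for j
        using P(3) by (simp add: p_def p'_def same_image_refl)
    qed (use P in \<open>auto simp: p_def p'_def\<close>)
    then obtain U1 where U1: "(move (2 + D + D * t))\<^sup>*\<^sup>* U U1"
      "\<forall>j\<in>J. marginal j U1 = marginal j U - p j + p' j" by blast
    have "\<exists>U'. (move (2 + D + D * t))\<^sup>*\<^sup>* U1 U' \<and> marginal i U' = (W + P') + Y1 \<and>
      (\<forall>j\<in>J - {i}. marginal j U' = marginal j U1)"
    proof (rule less.hyps)
      show "size X1 + size Y1 < size X + size Y"
        using P(7) X1 Y1 by (cases "P = {#}") (auto simp: nonempty_has_size)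
      show "table U1" using moves_table[OF U1(1) less.prems(1)] .
      show "marginal i U1 = (W + P') + X1" using U1(2) i mi by simp
      show "set_mset Y1 \<subseteq> {..<dim_col (fst (F i))}" using less.prems(3) Y1 by simp
      show "same_image (fst (F i)) X1 Y1"
        using less.prems(4) P(3) unfolding X1 Y1 same_image_def by simp
      show "image_mset (snd (F i)) X1 = image_mset (snd (F i)) Y1"
        using less.prems(5) P(4) unfolding X1 Y1 by simp
    qed
    then obtain U' where U': "(move (2 + D + D * t))\<^sup>*\<^sup>* U1 U'" "marginal i U' = W + Y"
      "\<forall>j\<in>J - {i}. marginal j U' = marginal j U1" unfolding Y1 by (auto simp: add.assoc)
    moreover have "\<forall>j\<in>J - {i}. marginal j U1 = marginal j U"
      using U1(2) by (simp add: p_def p'_def)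
    ultimately show ?thesis using U1(1) by (intro exI[of _ U']) auto
  qed
qed

lemma moves_equal_grade:
  assumes t: "\<And>j x. j \<in> J \<Longrightarrow> x < dim_col (fst (F j)) \<Longrightarrow> snd (F j) x < t"
    and steps: "\<And>j. j \<in> J \<Longrightarrow> kernel_steps (F j) D"
    and U: "table U" and V: "table V" and eq: "equivalent U V"
    and grade: "image_mset (snd G) U = image_mset (snd G) V"
  shows "(move (2 + D + D * t))\<^sup>*\<^sup>* U V"
proof -
  have "\<exists>U'. (move (2 + D + D * t))\<^sup>*\<^sup>* U U' \<and> (\<forall>j\<in>K. marginal j U' = marginal j V) \<and>
     (\<forall>j\<in>J - K. marginal j U' = marginal j U)" if "K \<subseteq> J" for K
    using finite_subset[OF that finite_factors] that
  proof (induction K rule: finite_induct)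
    case empty
    then show ?case by blast
  next
    case (insert i K)
    then obtain U1 where U1: "(move (2 + D + D * t))\<^sup>*\<^sup>* U U1" "\<forall>j\<in>K. marginal j U1 = marginal j V"
      "\<forall>j\<in>J - K. marginal j U1 = marginal j U" by auto
    have i: "i \<in> J" "i \<in> J - K" using insert by auto
    have tU1: "table U1" using moves_table[OF U1(1) U] .
    have "\<exists>U'. (move (2 + D + D * t))\<^sup>*\<^sup>* U1 U' \<and> marginal i U' = {#} + marginal i V \<and>
      (\<forall>j\<in>J - {i}. marginal j U' = marginal j U1)"
    proof (rule moves_one_marginal[OF t i(1) steps[OF i(1)] tU1])
      show "marginal i U1 = {#} + marginal i U" using U1(3) i by simp
      show "set_mset (marginal i V) \<subseteq> {..<dim_col (fst (F i))}" using marginal_cols[OF V i(1)] .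
      show "same_image (fst (F i)) (marginal i U) (marginal i V)"
        using eq i by (simp add: equivalent_def)
      show "image_mset (snd (F i)) (marginal i U) = image_mset (snd (F i)) (marginal i V)"
        using marginal_grades[OF U i(1)] marginal_grades[OF V i(1)] grade by simp
    qed
    then obtain U' where U': "(move (2 + D + D * t))\<^sup>*\<^sup>* U1 U'" "marginal i U' = marginal i V"
      "\<forall>j\<in>J - {i}. marginal j U' = marginal j U1" by auto
    moreover have "(move (2 + D + D * t))\<^sup>*\<^sup>* U U'" using U1(1) U'(1) by (rule rtranclp_trans)
    moreover have "marginal j U' = marginal j V" if "j \<in> insert i K" for j
      using that U'(2,3) U1(2) insert.prems by (cases "j = i") auto
    moreover have "marginal j U' = marginal j U" if "j \<in> J - insert i K" for j
      using that U'(3) U1(3) by auto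
    ultimately show ?case by blast
  qed
  from this[OF subset_refl] obtain U' where U': "(move (2 + D + D * t))\<^sup>*\<^sup>* U U'"
    "\<forall>j\<in>J. marginal j U' = marginal j V" by blast
  have "(move (2 + D + D * t))\<^sup>*\<^sup>* U' V"
    using moves_table[OF U'(1) U] V U'(2) by (intro moves_equal_marginals) auto
  with U'(1) show ?thesis by (rule rtranclp_trans)
qed

text \<open>
  Every fiber is connected: the grade is corrected in all factors together, after which the factors
  decouple and their marginals can be corrected one at a time.
\<close>

lemma moves_equivalent_tables:
  assumes t: "\<And>j x. j \<in> J \<Longrightarrow> x < dim_col (fst (F j)) \<Longrightarrow> snd (F j) x < t"
    and "grade_steps t (F ` J) D" and "\<And>j. j \<in> J \<Longrightarrow> kernel_steps (F j) D"
    and U: "table U" and V: "table V" and eq: "equivalent U V"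
  shows "(move (2 + D + D * t))\<^sup>*\<^sup>* U V"
proof -
  obtain U' where U': "(move (2 + D + D * t))\<^sup>*\<^sup>* U U'" "image_mset (snd G) U' = image_mset (snd G) V"
    using moves_to_grade[OF t assms(2) U V eq] by blast
  have "equivalent U' V"
    using equivalent_trans[OF equivalent_sym[OF moves_equivalent[OF U'(1)]] eq] .
  then have "(move (2 + D + D * t))\<^sup>*\<^sup>* U' V"
    using moves_equal_grade[OF t assms(3) moves_table[OF U'(1) U] V _ U'(2)] by blast
  with U'(1) show ?thesis by (rule rtranclp_trans)
qed

section \<open>From moves to the Markov degree\<close>

definition counts :: "nat multiset \<Rightarrow> int vec" where
  "counts U = vec (dim_col (fst G)) (\<lambda>q. int (count U q))"

lemma mult_counts_index:
  assumes "table U" "i < dim_row (fst G)"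
  shows "(fst G *\<^sub>v counts U) $ i = (\<Sum>q\<in>#U. fst G $$ (i, q))"
  using assms mult_mat_vec_index[of i "fst G" "counts U"]
    sum_mset_eq_sum_count[of U "dim_col (fst G)" "\<lambda>q. fst G $$ (i, q)"]
  by (simp add: counts_def table_def)

lemma sum_marginal:
  assumes "table U" "\<forall>q<dim_col (fst G). fst G $$ (i, q) = fst (F j) $$ (k, f q j)"
  shows "(\<Sum>q\<in>#U. fst G $$ (i, q)) = (\<Sum>x\<in>#marginal j U. fst (F j) $$ (k, x))"
  unfolding marginal_def image_mset.compositionality comp_def
  using assms by (intro arg_cong[of _ _ sum_mset] image_mset_cong) (auto simp: table_def)

lemma equivalent_iff:
  assumes "table U" "table V"
  shows "equivalent U V \<longleftrightarrow> fst G *\<^sub>v counts U = fst G *\<^sub>v counts V"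
proof
  assume eq: "equivalent U V"
  show "fst G *\<^sub>v counts U = fst G *\<^sub>v counts V"
  proof (rule eq_vecI)
    fix i assume "i < dim_vec (fst G *\<^sub>v counts V)"
    then have i: "i < dim_row (fst G)" by simp
    obtain j k where jk: "j \<in> J" "k < dim_row (fst (F j))"
      "\<forall>q<dim_col (fst G). fst G $$ (i, q) = fst (F j) $$ (k, f q j)"
      using row_from_factor[OF i] by blast
    then have "(\<Sum>x\<in>#marginal j U. fst (F j) $$ (k, x)) = (\<Sum>x\<in>#marginal j V. fst (F j) $$ (k, x))"
      using eq unfolding equivalent_def same_image_def by blast
    then show "(fst G *\<^sub>v counts U) $ i = (fst G *\<^sub>v counts V) $ i"
      using mult_counts_index assms i sum_marginal[OF _ jk(3)] by simp
  qed simp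
next
  assume eq: "fst G *\<^sub>v counts U = fst G *\<^sub>v counts V"
  show "equivalent U V"
    unfolding equivalent_def same_image_def
  proof (intro ballI allI impI)
    fix j k assume "j \<in> J" "k < dim_row (fst (F j))"
    from row_of_factor[OF this] obtain i where i: "i < dim_row (fst G)"
      "\<forall>q<dim_col (fst G). fst G $$ (i, q) = fst (F j) $$ (k, f q j)" by blast
    show "(\<Sum>x\<in>#marginal j U. fst (F j) $$ (k, x)) = (\<Sum>x\<in>#marginal j V. fst (F j) $$ (k, x))"
      using mult_counts_index[OF assms(1) i(1)] mult_counts_index[OF assms(2) i(1)] eq
        sum_marginal[OF assms(1) i(2)] sum_marginal[OF assms(2) i(2)] by simp
  qed
qed

lemma fiber_counts: "counts U \<in> fiber (fst G) b \<longleftrightarrow> fst G *\<^sub>v counts U = b"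
  unfolding fiber_def counts_def by (auto simp: less_eq_vec_def)

lemma fiber_countsE:
  assumes "u \<in> fiber (fst G) b"
  obtains U where "table U" "u = counts U"
proof -
  have u0: "u \<in> carrier_vec (dim_col (fst G))" "0\<^sub>v (dim_col (fst G)) \<le> u"
    using assms unfolding fiber_def by blast+
  have u: "0 \<le> u $ q" if "q < dim_col (fst G)" for q
    using u0 that unfolding less_eq_vec_def by simp
  obtain U where "set_mset U \<subseteq> Q" "\<And>q. q < dim_col (fst G) \<Longrightarrow> int (count U q) = u $ q"
    using multiset_with_counts[of "dim_col (fst G)" "\<lambda>q. u $ q", OF u] by metis
  with u0(1) show thesis by (intro that[of U]) (auto simp: table_def counts_def)
qed

lemma vec_deg_move:
  assumes "move C U V"
  shows "vec_deg (counts U - counts V) \<le> C"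
proof -
  obtain W T T' where W: "U = W + T" "V = W + T'" "size T \<le> C" "size T' \<le> C"
    using assms unfolding move_def by blast
  have tT: "table T" "table T'" using move_table[OF assms] W by auto
  have count_size: "(\<Sum>q<dim_col (fst G). count S q) = size S" if "table S" for S
    using that unfolding size_multiset_overloaded_eq table_def
    by (intro sum.mono_neutral_right) (auto simp: count_eq_zero_iff)
  have "(\<Sum>q<dim_col (fst G). nat (int (count U q) - int (count V q))) \<le> (\<Sum>q<dim_col (fst G). count T q)"
    "(\<Sum>q<dim_col (fst G). nat (- (int (count U q) - int (count V q)))) \<le> (\<Sum>q<dim_col (fst G). count T' q)"
    unfolding W by (auto intro!: sum_mono)
  then show ?thesis
    unfolding vec_deg_def count_size[OF tT(1)] count_size[OF tT(2)]
    using W(3,4) by (simp add: counts_def)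
qed

text \<open>
  All integer vectors of degree at most \<open>C\<close> together form a Markov basis, since the difference of two
  tables joined by a move is such a vector.
\<close>

lemma mardeg_le:
  assumes conn: "\<And>U V. table U \<Longrightarrow> table V \<Longrightarrow> equivalent U V \<Longrightarrow> (move C)\<^sup>*\<^sup>* U V"
  shows "mardeg (fst G) \<le> enat C"
proof -
  define S where "S = {z \<in> carrier_vec (dim_col (fst G)). vec_deg z \<le> C}"
  have path: "(counts U, counts V) \<in> (fiber_edges (fst G) S b)\<^sup>*"
    if "(move C)\<^sup>*\<^sup>* U V" "table U" "counts U \<in> fiber (fst G) b" for U V b
    using that(1)
  proof (induction rule: rtranclp_induct)
    case (step V W)
    have "counts X \<in> fiber (fst G) b" if "(move C)\<^sup>*\<^sup>* U X" for X
      using equivalent_iff[OF _ moves_table[OF that]] moves_equivalent[OF that]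
        \<open>table U\<close> \<open>counts U \<in> fiber (fst G) b\<close> that unfolding fiber_counts by metis
    then have "counts V \<in> fiber (fst G) b" "counts W \<in> fiber (fst G) b"
      using step.hyps by (auto intro: rtranclp.rtrancl_into_rtrancl)
    then have "(counts V, counts W) \<in> fiber_edges (fst G) S b"
      using vec_deg_move[OF step.hyps(2)] unfolding fiber_edges_def S_def by (auto simp: counts_def)
    with step.IH show ?case by (rule rtrancl_into_rtrancl)
  qed simp
  have "markov_basis (fst G) S"
    unfolding markov_basis_def
  proof (intro conjI ballI)
    show "S \<subseteq> carrier_vec (dim_col (fst G))" by (auto simp: S_def)
  next
    fix b u v assume u: "u \<in> fiber (fst G) b" and v: "v \<in> fiber (fst G) b"
    obtain U where U: "table U" "u = counts U" using fiber_countsE[OF u] .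
    obtain V where V: "table V" "v = counts V" using fiber_countsE[OF v] .
    have "equivalent U V"
      using u v U V equivalent_iff by (simp add: fiber_counts)
    then show "(u, v) \<in> (fiber_edges (fst G) S b)\<^sup>*"
      using path[OF conn[OF U(1) V(1)] U(1)] u U V by simp
  qed
  then have "mardeg (fst G) \<le> set_deg S" unfolding mardeg_def by (intro INF_lower) simp
  also have "\<dots> \<le> enat C" unfolding set_deg_def by (intro SUP_least) (simp add: S_def)
  finally show ?thesis .
qed

end

text \<open>
  The bound depends only on the finite set of factors that occur, not on their multiplicities.
\<close>

lemma mardeg_bounded_for_factors:
  assumes fin: "finite I"
    and normal: "\<And>B \<phi>. (B, \<phi>) \<in> I \<Longrightarrow> normal_semigroup (augmented_mat t B \<phi>)"
    and t: "\<And>B \<phi> x. (B, \<phi>) \<in> I \<Longrightarrow> x < dim_col B \<Longrightarrow> \<phi> x < t"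
  shows "\<exists>C. \<forall>G (J :: 'j set) F f. fiber_product G J F f \<longrightarrow> F ` J = I \<longrightarrow> mardeg (fst G) \<le> enat C"
proof (cases "I = {}")
  case True
  then show ?thesis using fiber_product.factors_nonempty by blast
next
  case False
  have "\<exists>D. grade_steps t I D"
    using fin False normal t by (rule grade_steps_exist)
  then obtain D0 where D0: "grade_steps t I D0" ..
  obtain \<kappa> where \<kappa>: "\<And>G. kernel_steps G (\<kappa> G)" using kernel_steps_exist by metis
  define D where "D = D0 + (\<Sum>G\<in>I. \<kappa> G)"
  have gD: "grade_steps t I D" using D0 by (rule grade_steps_mono) (simp add: D_def)
  have kD: "kernel_steps G D" if "G \<in> I" for G
    using \<kappa> by (rule kernel_steps_mono)
      (use member_le_sum[OF that, of \<kappa>] fin in \<open>auto simp: D_def trans_le_add2\<close>)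
  have "mardeg (fst G) \<le> enat (2 + D + D * t)"
    if "fiber_product G J F f" "F ` J = I" for G F f and J :: "'j set"
  proof -
    interpret fiber_product G J F f by (rule that)
    have F: "(fst (F j), snd (F j)) \<in> I" if "j \<in> J" for j using that \<open>F ` J = I\<close> by auto
    show ?thesis
    proof (rule mardeg_le, rule moves_equivalent_tables)
      show "snd (F j) x < t" if "j \<in> J" "x < dim_col (fst (F j))" for j x
        using t[OF F] that by blast
      show "grade_steps t (F ` J) D" using gD that by simp
      show "kernel_steps (F j) D" if "j \<in> J" for j using kD F[OF that] by simp
    qed
  qed
  then show ?thesis by blast
qed

text \<open>
  The factors of the nested product are indexed by pairs: the position of a power and the position of a
  copy within it.
\<close>

lemma fiber_product_tfp_powers:
  assumes "Is \<noteq> []" "\<And>i. i \<in> set Is \<Longrightarrow> r i \<noteq> 0"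
  shows "\<exists>F f (J :: (nat \<times> nat) set).
    fiber_product (toric_fiber_product (map (\<lambda>i. tfp_power (r i) (H i)) Is)) J F f \<and> F ` J = H ` set Is"
proof -
  define Cs where "Cs = map (\<lambda>i. tfp_power (r i) (H i)) Is"
  define R where "R p = replicate (r (Is ! p)) (H (Is ! p))" for p
  have outer: "fiber_product (toric_fiber_product Cs) {..<length Is} ((!) Cs) (\<lambda>q j. tfp_tuples Cs ! q ! j)"
    using fiber_product_toric_fiber_product[of Cs] assms(1) by (simp add: Cs_def)
  have inner: "fiber_product (Cs ! p) {..<r (Is ! p)} ((!) (R p)) (\<lambda>q j. tfp_tuples (R p) ! q ! j)"
    if "p \<in> {..<length Is}" for p
    using fiber_product_toric_fiber_product[of "R p"] that assms(2)[of "Is ! p"]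
    by (simp add: Cs_def R_def tfp_power_def)
  have "(\<lambda>(p, l). R p ! l) ` (SIGMA p:{..<length Is}. {..<r (Is ! p)}) = H ` set Is"
  proof
    show "(\<lambda>(p, l). R p ! l) ` (SIGMA p:{..<length Is}. {..<r (Is ! p)}) \<subseteq> H ` set Is"
      by (auto simp: R_def)
    show "H ` set Is \<subseteq> (\<lambda>(p, l). R p ! l) ` (SIGMA p:{..<length Is}. {..<r (Is ! p)})"
    proof
      fix h assume "h \<in> H ` set Is"
      then obtain p where "p < length Is" "h = H (Is ! p)" by (auto simp: in_set_conv_nth)
      moreover from this have "0 < r (Is ! p)" using assms(2) by simp
      ultimately show "h \<in> (\<lambda>(p, l). R p ! l) ` (SIGMA p:{..<length Is}. {..<r (Is ! p)})"
        by (intro image_eqI[of _ _ "(p, 0)"]) (auto simp: R_def)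
    qed
  qed
  with fiber_product_compose[OF outer inner] show ?thesis
    unfolding Cs_def by (intro exI conjI)
qed

theorem theorem54:
  fixes A :: "int mat" and s :: nat
    and B :: "nat \<Rightarrow> int mat" and \<phi> :: "nat \<Rightarrow> nat \<Rightarrow> nat"
  assumes "\<And>i. i < s \<Longrightarrow> graded_by A (B i) (\<phi> i)"
    and "\<And>i. i < s \<Longrightarrow> normal_semigroup (augmented_mat (dim_col A) (B i) (\<phi> i))"
  shows "\<exists>C::nat. \<forall>r::nat \<Rightarrow> nat. (\<exists>i<s. r i \<noteq> 0) \<longrightarrow>
    mardeg (fst (toric_fiber_product
      (map (\<lambda>i. tfp_power (r i) (B i, \<phi> i)) (filter (\<lambda>i. r i \<noteq> 0) [0..<s])))) \<le> enat C"
proof -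
  define H where "H i = (B i, \<phi> i)" for i
  \<comment> \<open>The set of factors that occur is one of finitely many, and their bounds are added up.\<close>
  have "\<exists>C. \<forall>G (J :: (nat \<times> nat) set) F f. fiber_product G J F f \<longrightarrow> F ` J = H ` K \<longrightarrow> mardeg (fst G) \<le> enat C"
    if K: "K \<subseteq> {..<s}" for K
  proof (rule mardeg_bounded_for_factors)
    show "finite (H ` K)" using K by (simp add: finite_subset)
    show "normal_semigroup (augmented_mat (dim_col A) B' \<phi>')" if "(B', \<phi>') \<in> H ` K" for B' \<phi>'
      using that K assms(2) by (auto simp: H_def)
    show "\<phi>' x < dim_col A" if "(B', \<phi>') \<in> H ` K" "x < dim_col B'" for B' \<phi>' x
      using that K assms(1) unfolding graded_by_def H_def by blast
  qed
  then obtain C where C: "\<And>K G (J :: (nat \<times> nat) set) F f. K \<subseteq> {..<s} \<Longrightarrow> fiber_product G J F f \<Longrightarrow>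
      F ` J = H ` K \<Longrightarrow> mardeg (fst G) \<le> enat (C K)" by metis
  show ?thesis
  proof (intro exI[of _ "\<Sum>K\<in>Pow {..<s}. C K"] allI impI)
    fix r :: "nat \<Rightarrow> nat" assume r: "\<exists>i<s. r i \<noteq> 0"
    define Is where "Is = filter (\<lambda>i. r i \<noteq> 0) [0..<s]"
    have Is: "Is \<noteq> []" "set Is \<subseteq> {..<s}" "\<And>i. i \<in> set Is \<Longrightarrow> r i \<noteq> 0"
      using r by (auto simp: Is_def filter_empty_conv)
    obtain F f and J :: "(nat \<times> nat) set" where
      "fiber_product (toric_fiber_product (map (\<lambda>i. tfp_power (r i) (H i)) Is)) J F f" "F ` J = H ` set Is"
      using fiber_product_tfp_powers[of Is r H, OF Is(1) Is(3)] by blast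
    then have "mardeg (fst (toric_fiber_product (map (\<lambda>i. tfp_power (r i) (H i)) Is))) \<le> enat (C (set Is))"
      using C Is(2) by blast
    also have "\<dots> \<le> enat (\<Sum>K\<in>Pow {..<s}. C K)"
      using Is(2) by (simp add: member_le_sum)
    finally show "mardeg (fst (toric_fiber_product
      (map (\<lambda>i. tfp_power (r i) (B i, \<phi> i)) (filter (\<lambda>i. r i \<noteq> 0) [0..<s])))) \<le> enat (\<Sum>K\<in>Pow {..<s}. C K)"
      unfolding Is_def H_def .
  qed
qed

end
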